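(* There exist a standard probability space $(X,\mu)$, an ergodic automorphism $T\in\mathrm{Aut}(X,\mu)$, a finite generating partition $\alpha$ of $X$ (generating for $T$), and an increasing sequence $\{\mathcal{P}_n\}_{n=1}^{\infty}$ of finite measurable partitions of $X$ such that $\bigvee_{n=1}^{\infty}\mathcal{P}_n$ is the partition into points and $$f_\mu(\alpha)=h_\mu(T)\neq\liminf_{n\to\infty}H_\mu(\mathcal{P}_n\mid T^{-1}\mathcal{P}_n)=\liminf_{n\to\infty}F_\mu(\mathcal{P}_n).$$
   Context: $\mathrm{Aut}(X,\mu)$ denotes the group of invertible measure-preserving transformations of the standard probability space $(X,\mu)$. All partitions are measurable and relations between them are understood modulo $\mu$-null sets. For a finite partition $\mathcal{P}$, $H_\mu(\mathcal{P})=-\sum_{P\in\mathcal{P}}\mu(P)\log\mu(P)$ is its Shannon entropy (with $0\log 0=0$), $\mathcal{P}\vee\mathcal{Q}$ is the common refinement of $\mathcal{P}$ and $\mathcal{Q}$, and $H_\mu(\mathcal{P}\mid\mathcal{Q})=H_\mu(\mathcal{P}\vee\mathcal{Q})-H_\mu(\mathcal{Q})$. $T^{j}\mathcal{P}=\{T^jP: P\in\mathcal{P}\}$ for $j\in\mathbb{Z}$. A sequence of partitions is increasing if $\mathcal{P}_{n+1}$ refines $\mathcal{P}_n$ for every $n$. That $\bigvee_{n}\mathcal{P}_n$ is the partition into points means that the $\sigma$-algebra generated by all the $\mathcal{P}_n$ is, modulo null sets, the full measurable $\sigma$-algebra of $X$ (equivalently, the $\mathcal{P}_n$ separate points of a conull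 set). The partition $\alpha$ is generating for $T$ if the smallest $T$-invariant $\sigma$-algebra (invariant under $T$ and $T^{-1}$) containing $\alpha$ is, modulo null sets, the full $\sigma$-algebra. $h_\mu(T)$ is the Kolmogorov–Sinai entropy of $T$. The functionals $F_\mu$ and $f_\mu$ are those of the $f$-invariant of free group actions, here for the group $\mathbb{Z}$ (free group of rank $1$) acting through $T$. For a measure-preserving action of the free group $\langle s_1,\dots,s_r\rangle$ and a finite partition $\mathcal{P}$, $$F_\mu(\mathcal{P})=(1-2r)H_\mu(\mathcal{P})+\sum_{i=1}^r H_\mu(\mathcal{P}\vee s_i^{-1}\mathcal{P}),\qquad f_\mu(\mathcal{P})=\inf_{n\ge 1}F_\mu(\mathcal{P}^n),$$ where $\mathcal{P}^n=\bigvee_{g\in B(e,n)}g^{-1}\mathcal{P}$ and $B(e,n)$ is the ball of radius $n$ about the identity in the word metric. For $r=1$ with generator acting by $T$ this reads $F_\mu(\mathcal{P})=H_\mu(\mathcal{P}\vee T^{-1}\mathcal{P})-H_\mu(\mathcal{P})$ and $\mathcal{P}^n=\bigvee_{j=-n}^{n}T^{j}\mathcal{P}$. *)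

theory Defs
  imports "HOL-Probability.Probability"
begin

text \<open>The sigma-algebra is the Borel algebra of a Polish topology on the underlying set;
  no completion is taken.\<close>

definition standard_prob_space :: "'a measure \<Rightarrow> bool" where
  "standard_prob_space M \<longleftrightarrow>
     prob_space M \<and>
     (\<exists>X. topspace X = space M \<and> completely_metrizable_space X \<and> second_countable X \<and>
          sets M = sigma_sets (space M) {U. openin X U})"

definition mp_automorphism :: "'a measure \<Rightarrow> ('a \<Rightarrow> 'a) \<Rightarrow> bool" where
  "mp_automorphism M T \<longleftrightarrow>
     bij_betw T (space M) (space M) \<and>
     T \<in> M \<rightarrow>\<^sub>M M \<and> the_inv_into (space M) T \<in> M \<rightarrow>\<^sub>M M \<and>
     distr M M T = M"

definition ergodic :: "'a measure \<Rightarrow> ('a \<Rightarrow> 'a) \<Rightarrow> bool" where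
  "ergodic M T \<longleftrightarrow>
     (\<forall>A\<in>sets M. T -` A \<inter> space M = A \<longrightarrow> measure M A = 0 \<or> measure M A = 1)"

definition finite_partition :: "'a measure \<Rightarrow> 'a set set \<Rightarrow> bool" where
  "finite_partition M P \<longleftrightarrow> finite P \<and> P \<subseteq> sets M \<and> partition_on (space M) P"

definition refines_mod_null :: "'a measure \<Rightarrow> 'a set set \<Rightarrow> 'a set set \<Rightarrow> bool" where
  "refines_mod_null M P Q \<longleftrightarrow> (\<forall>A\<in>P. \<exists>B\<in>Q. A - B \<in> null_sets M)"

definition full_mod_null :: "'a measure \<Rightarrow> 'a set set \<Rightarrow> bool" where
  "full_mod_null M S \<longleftrightarrow> (\<forall>A\<in>sets M. \<exists>B\<in>S. sym_diff A B \<in> null_sets M)"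

definition invariant_sigma_algebra :: "'a measure \<Rightarrow> ('a \<Rightarrow> 'a) \<Rightarrow> 'a set set \<Rightarrow> bool" where
  "invariant_sigma_algebra M T S \<longleftrightarrow>
     sigma_algebra (space M) S \<and> (\<forall>A\<in>S. T ` A \<in> S \<and> T -` A \<inter> space M \<in> S)"

definition generating :: "'a measure \<Rightarrow> ('a \<Rightarrow> 'a) \<Rightarrow> 'a set set \<Rightarrow> bool" where
  "generating M T P \<longleftrightarrow>
     full_mod_null M (\<Inter>{S. invariant_sigma_algebra M T S \<and> P \<subseteq> S})"

definition int_iterate :: "'a measure \<Rightarrow> ('a \<Rightarrow> 'a) \<Rightarrow> int \<Rightarrow> 'a \<Rightarrow> 'a" where
  "int_iterate M T j =
     (if 0 \<le> j then T ^^ nat j else the_inv_into (space M) T ^^ nat (- j))"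

definition translate :: "'a measure \<Rightarrow> ('a \<Rightarrow> 'a) \<Rightarrow> int \<Rightarrow> 'a set set \<Rightarrow> 'a set set" where
  "translate M T j P = (\<lambda>A. int_iterate M T j ` A) ` P"

definition join :: "'a set set \<Rightarrow> 'a set set \<Rightarrow> 'a set set" where
  "join P Q = common_refinement {P, Q}"

text \<open>Logarithms are natural; since \<open>ln 0 = 0\<close>, null cells contribute nothing.\<close>

definition partition_entropy :: "'a measure \<Rightarrow> 'a set set \<Rightarrow> real" where
  "partition_entropy M P = - (\<Sum>A\<in>P. measure M A * ln (measure M A))"

definition cond_partition_entropy :: "'a measure \<Rightarrow> 'a set set \<Rightarrow> 'a set set \<Rightarrow> real" where
  "cond_partition_entropy M P Q = partition_entropy M (join P Q) - partition_entropy M Q"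

definition entropy_rate :: "'a measure \<Rightarrow> ('a \<Rightarrow> 'a) \<Rightarrow> 'a set set \<Rightarrow> ereal" where
  "entropy_rate M T P =
     lim (\<lambda>n. ereal (partition_entropy M
       (common_refinement ((\<lambda>i. translate M T (- int i) P) ` {..<n})) / real n))"

definition ks_entropy :: "'a measure \<Rightarrow> ('a \<Rightarrow> 'a) \<Rightarrow> ereal" where
  "ks_entropy M T = (SUP P\<in>{P. finite_partition M P}. entropy_rate M T P)"

text \<open>For the free group of rank \<open>r\<close> the coefficient of the entropy of \<open>P\<close> is \<open>1 - 2 * r\<close>,
  and the ball of radius \<open>n\<close> is taken in the word metric; here \<open>r = 1\<close>, so the ball in the
  integers is \<open>{- n..n}\<close>.\<close>

definition F_functional :: "'a measure \<Rightarrow> ('a \<Rightarrow> 'a) \<Rightarrow> 'a set set \<Rightarrow> real" where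
  "F_functional M T P =
     partition_entropy M (join P (translate M T (- 1) P)) - partition_entropy M P"

definition ball_refinement :: "'a measure \<Rightarrow> ('a \<Rightarrow> 'a) \<Rightarrow> nat \<Rightarrow> 'a set set \<Rightarrow> 'a set set" where
  "ball_refinement M T n P = common_refinement ((\<lambda>j. translate M T j P) ` {- int n..int n})"

definition f_functional :: "'a measure \<Rightarrow> ('a \<Rightarrow> 'a) \<Rightarrow> 'a set set \<Rightarrow> ereal" where
  "f_functional M T P = (INF n\<in>{1..}. ereal (F_functional M T (ball_refinement M T n P)))"

end

theory Submission
  imports Defs
begin

text \<open>
  The example is the dyadic odometer \<open>x \<mapsto> x + 1\<close> on the \<open>2\<close>-adic integers with Haar measure. Its
  entropy is \<open>0\<close>, because the partition into residue classes mod \<open>2 ^ k\<close> is permuted by the map and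
  these partitions approximate every measurable set. A partition that is itself permuted has
  \<open>F = 0\<close>, so a sequence that keeps \<open>F\<close> away from \<open>0\<close> must break this symmetry: the map exchanges
  even and odd points, and \<open>P n\<close> splits the even points into classes mod \<open>2 ^ n\<close> but the odd points
  into classes mod \<open>2 ^ (n + 1)\<close> (\<open>staggered\<close>). Pulling \<open>P n\<close> back by the map interchanges the
  two resolutions, so that the join with \<open>P n\<close> is the full partition mod \<open>2 ^ (n + 1)\<close>. Its entropy
  is \<open>(n + 1) ln 2\<close>, the average of the two resolutions gives \<open>P n\<close> the entropy \<open>(n + 1/2) ln 2\<close>,
  and \<open>F\<close> is \<open>ln 2 / 2\<close> for every \<open>n \<ge> 1\<close> (\<open>F_functional_staggered\<close>). The conditional entropies agree
  with the values of \<open>F\<close> because the map preserves entropy.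

  The finite generator records whether the first binary digit \<open>0\<close> of a point stands at an even
  position (\<open>toeplitz\<close>); the orbit names are the period doubling sequences. For a point whose
  first \<open>k\<close> digits are all \<open>1\<close>, the next digit can be read off from two symbols of its name
  (\<open>ones_Suc_iff\<close>), and the residue of any point is found by following its orbit to such a point.

  Both entropy functionals vanish once the entropy of words of length \<open>n\<close> is \<open>o(n)\<close> for every
  finite labelling of the points. This is proved by coding (\<open>label_entropy_word_le\<close>). Choose a
  function of the residue mod \<open>2 ^ k\<close> that agrees with the labelling outside a set of measure \<open>e\<close>. To describe
  a word, give the residue of the starting point, which costs \<open>k ln 2\<close> and determines the word of the
  approximation, and then correct the errors symbol by symbol at an average price that tends to \<open>0\<close>
  with \<open>e\<close>. Gibbs' inequality turns the code into a bound for the entropy. For \<open>f\<close>, the values of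
  the functional \<open>F\<close> on ball refinements are every other increment of the word entropies, and increments of a
  sublinear monotone sequence have infimum \<open>0\<close>.

  Partitions are handled as the level sets of functions (labellings): joins become pairs of labels
  and translates become compositions. The odometer is treated axiomatically through its residue
  maps, and a model is transported from coin sequences to the reals along an arbitrary bijection.
\<close>

section \<open>Partitions as labellings\<close>

definition label_partition :: "'a measure \<Rightarrow> ('a \<Rightarrow> 'b) \<Rightarrow> 'a set set" where
  "label_partition M F = (\<lambda>b. F -` {b} \<inter> space M) ` (F ` space M)"

definition label_entropy :: "'a measure \<Rightarrow> ('a \<Rightarrow> 'b) \<Rightarrow> real" where
  "label_entropy M F =
     - (\<Sum>b\<in>F ` space M. measure M (F -` {b} \<inter> space M) * ln (measure M (F -` {b} \<inter> space M)))"

lemma label_partition_eq_cells: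
  "label_partition M F = (\<lambda>x. {y \<in> space M. F y = F x}) ` space M"
  by (auto simp: label_partition_def image_image vimage_def Int_def intro!: image_cong)

lemma partition_entropy_label: "partition_entropy M (label_partition M F) = label_entropy M F"
proof -
  have "inj_on (\<lambda>b. F -` {b} \<inter> space M) (F ` space M)"
    by (auto simp: inj_on_def)
  then show ?thesis
    by (simp add: partition_entropy_def label_entropy_def label_partition_def sum.reindex)
qed

lemma label_partition_cong:
  assumes "\<And>x y. x \<in> space M \<Longrightarrow> y \<in> space M \<Longrightarrow> F x = F y \<longleftrightarrow> G x = G y"
  shows "label_partition M F = label_partition M G"
  unfolding label_partition_eq_cells using assms by (intro image_cong) auto

lemma label_entropy_cong:
  assumes "\<And>x y. x \<in> space M \<Longrightarrow> y \<in> space M \<Longrightarrow> F x = F y \<longleftrightarrow> G x = G y"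
  shows "label_entropy M F = label_entropy M G"
  using label_partition_cong[of M F G] assms by (metis partition_entropy_label)

lemma finite_partition_label:
  assumes "simple_function M F"
  shows "finite_partition M (label_partition M F)"
  using assms unfolding finite_partition_def simple_function_def label_partition_def
  by (auto simp: partition_on_def disjoint_def)

lemma finite_partition_has_label:
  assumes P: "finite_partition M P"
  obtains F :: "'a \<Rightarrow> 'a set" where "simple_function M F" "P = label_partition M F"
proof -
  define F where "F x = (THE A. A \<in> P \<and> x \<in> A)" for x
  have part: "partition_on (space M) P" "finite P" "P \<subseteq> sets M"
    using P by (auto simp: finite_partition_def)
  have F: "F x = A" if "A \<in> P" "x \<in> A" for x A
    unfolding F_def
  proof (rule the_equality)
    show "B = A" if "B \<in> P \<and> x \<in> B" for B
      using that \<open>A \<in> P\<close> \<open>x \<in> A\<close> part(1) by (auto simp: partition_on_def disjoint_def)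
  qed (use that in auto)
  have ex: "\<exists>A\<in>P. x \<in> A" if "x \<in> space M" for x
    using that part(1) by (auto simp: partition_on_def)
  have cell: "F -` {A} \<inter> space M = A" if "A \<in> P" for A
    using that F ex part(1) by (fastforce simp: partition_on_def)
  have img: "F ` space M = P"
  proof
    show "F ` space M \<subseteq> P" using ex F by auto
    show "P \<subseteq> F ` space M"
    proof
      fix A assume "A \<in> P"
      then obtain x where "x \<in> A" "x \<in> space M"
        using part(1) unfolding partition_on_def by (metis UnionI all_not_in_conv)
      then show "A \<in> F ` space M" using F[OF \<open>A \<in> P\<close>] by blast
    qed
  qed
  show ?thesis
  proof
    show "simple_function M F"
      unfolding simple_function_def using img cell part by auto
    show "P = label_partition M F"
      unfolding label_partition_def img using cell by auto
  qed
qed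

text \<open>
  A nonempty member of the common refinement is the intersection of the cells through any one of its
  points, that is, a level set of the tuple of labels.
\<close>

lemma common_refinement_label:
  assumes "I \<noteq> {}"
  shows "common_refinement ((\<lambda>i. label_partition M (F i)) ` I)
       = label_partition M (\<lambda>x. \<lambda>i\<in>I. F i x)"
proof -
  define C where "C i x = {y \<in> space M. F i y = F i x}" for i x
  have lab: "label_partition M (\<lambda>x. \<lambda>i\<in>I. F i x) = (\<lambda>x. \<Inter>i\<in>I. C i x) ` space M"
    unfolding label_partition_eq_cells using assms
    by (intro image_cong) (auto simp: C_def restrict_def fun_eq_iff split: if_splits)
  have lp: "label_partition M (F i) = C i ` space M" for i
    by (simp add: label_partition_eq_cells C_def)
  show ?thesis
    unfolding lab
  proof (intro equalityI subsetI)
    fix X assume "X \<in> common_refinement ((\<lambda>i. label_partition M (F i)) ` I)"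
    then obtain f x where f: "\<And>i. i \<in> I \<Longrightarrow> f (label_partition M (F i)) \<in> label_partition M (F i)"
      and X: "X = (\<Inter>i\<in>I. f (label_partition M (F i)))" and x: "x \<in> X"
      by (auto simp: common_refinement Pi_iff)
    have *: "f (label_partition M (F i)) = C i x \<and> x \<in> space M" if i: "i \<in> I" for i
    proof -
      obtain y where "y \<in> space M" "f (label_partition M (F i)) = C i y"
        using f[OF i] by (auto simp: lp)
      moreover have "x \<in> f (label_partition M (F i))" using x X i by auto
      ultimately show ?thesis by (auto simp: C_def)
    qed
    then show "X \<in> (\<lambda>x. \<Inter>i\<in>I. C i x) ` space M"
      using X assms by (auto intro!: image_eqI[of _ _ x])
  next
    fix X assume "X \<in> (\<lambda>x. \<Inter>i\<in>I. C i x) ` space M"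
    then obtain x where x: "x \<in> space M" "X = (\<Inter>i\<in>I. C i x)" by auto
    define f where "f P = \<Union>{A \<in> P. x \<in> A}" for P
    have f: "f (label_partition M (F i)) = C i x" for i
      using x by (auto simp: f_def lp C_def)
    have "f (label_partition M (F i)) \<in> label_partition M (F i)" for i
      unfolding f using x by (auto simp: lp)
    moreover have "x \<in> X" using x by (auto simp: C_def)
    moreover have "X = \<Inter> (f ` (\<lambda>i. label_partition M (F i)) ` I)"
      by (simp add: image_image f x)
    ultimately show "X \<in> common_refinement ((\<lambda>i. label_partition M (F i)) ` I)"
      by (auto simp: common_refinement Pi_iff intro!: exI[of _ f])
  qed
qed

lemma join_label:
  "join (label_partition M F) (label_partition M G) = label_partition M (\<lambda>x. (F x, G x))"
proof -
  \<comment> \<open>The tuple lemma wants a common label type, so the two label types are merged.\<close>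
  define H where "H b x = (if b then (Some (F x), None) else (None, Some (G x)))" for b x
  have "label_partition M F = label_partition M (H True)"
       "label_partition M G = label_partition M (H False)"
    by (auto intro!: label_partition_cong simp: H_def)
  then have "join (label_partition M F) (label_partition M G)
    = common_refinement ((\<lambda>b. label_partition M (H b)) ` UNIV)"
    by (auto simp: join_def UNIV_bool insert_commute)
  also have "\<dots> = label_partition M (\<lambda>x. \<lambda>b\<in>UNIV. H b x)"
    by (rule common_refinement_label) auto
  also have "\<dots> = label_partition M (\<lambda>x. (F x, G x))"
    by (intro label_partition_cong) (auto simp: H_def fun_eq_iff split: if_splits)
  finally show ?thesis .
qed

section \<open>Entropy of a labelling\<close>

context prob_space
begin

lemma label_entropy_nonneg: "0 \<le> label_entropy M F"
proof -
  have "(\<Sum>b\<in>F ` space M. prob (F -` {b} \<inter> space M) * ln (prob (F -` {b} \<inter> space M))) \<le> 0"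
  proof (intro sum_nonpos mult_nonneg_nonpos)
    show "ln (prob A) \<le> 0" for A
      by (cases "prob A = 0") (simp_all add: zero_less_measure_iff ln_le_zero_iff)
  qed simp
  then show ?thesis by (simp add: label_entropy_def)
qed

lemma label_entropy_superset:
  assumes "finite B" "F ` space M \<subseteq> B"
  shows "label_entropy M F = - (\<Sum>b\<in>B. prob (F -` {b} \<inter> space M) * ln (prob (F -` {b} \<inter> space M)))"
proof -
  have "F -` {b} \<inter> space M = {}" if "b \<in> B - F ` space M" for b using that by auto
  then show ?thesis
    unfolding label_entropy_def using assms
    by (intro arg_cong[of _ _ uminus] sum.mono_neutral_left) auto
qed

lemma label_entropy_mono:
  assumes G: "simple_function M G" and F: "\<And>x. x \<in> space M \<Longrightarrow> F x = g (G x)"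
  shows "label_entropy M F \<le> label_entropy M G"
proof -
  define p where "p b = prob (F -` {b} \<inter> space M)" for b
  define q where "q c = prob (G -` {c} \<inter> space M)" for c
  have fin: "finite (G ` space M)" using G by (simp add: simple_function_def)
  have meas: "G -` {c} \<inter> space M \<in> events" for c
    using G by (rule simple_functionD(2))
  have img: "F ` space M = g ` G ` space M" using F by (auto simp: image_image)
  have Fsimple: "simple_function M F"
    using simple_function_compose1[OF G, of g] F by (simp cong: simple_function_cong)
  have measF: "F -` {b} \<inter> space M \<in> events" for b
    using Fsimple by (rule simple_functionD(2))
  have p: "p b = (\<Sum>c\<in>{c \<in> G ` space M. g c = b}. q c)" for b
  proof -
    have "F -` {b} \<inter> space M = (\<Union>c\<in>{c \<in> G ` space M. g c = b}. G -` {c} \<inter> space M)"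
      using F by auto
    then have "p b = prob (\<Union>c\<in>{c \<in> G ` space M. g c = b}. G -` {c} \<inter> space M)"
      by (simp add: p_def)
    also have "\<dots> = (\<Sum>c\<in>{c \<in> G ` space M. g c = b}. q c)"
      unfolding q_def using fin meas
      by (intro finite_measure_finite_Union) (auto simp: disjoint_family_on_def)
    finally show ?thesis .
  qed
  have le: "q c * ln (q c) \<le> q c * ln (p (g c))" if "c \<in> G ` space M" for c
  proof (cases "q c = 0")
    case False
    then have "0 < q c" by (simp add: q_def zero_less_measure_iff)
    moreover have "q c \<le> p (g c)" unfolding p_def q_def
      by (rule finite_measure_mono) (use F measF in auto)
    ultimately show ?thesis by (intro mult_left_mono) auto
  qed simp
  have "(\<Sum>c\<in>G ` space M. q c * ln (q c)) \<le> (\<Sum>c\<in>G ` space M. q c * ln (p (g c)))"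
    by (intro sum_mono le)
  also have "\<dots> = (\<Sum>b\<in>F ` space M. \<Sum>c\<in>{c \<in> G ` space M. g c = b}. q c * ln (p (g c)))"
    using fin by (subst sum.group) (auto simp: img)
  also have "\<dots> = (\<Sum>b\<in>F ` space M. p b * ln (p b))"
    by (intro sum.cong refl, subst (2) p) (simp add: sum_distrib_right)
  finally show ?thesis by (simp add: label_entropy_def p_def q_def)
qed

text \<open>
  Gibbs' inequality, in the form used for coding: any subprobability \<open>q\<close> on the labels bounds the
  entropy by the expected code length \<open>- ln q\<close>. It follows termwise from \<open>ln t \<le> t - 1\<close>.
\<close>

lemma label_entropy_le_cross_entropy:
  assumes W: "simple_function M W" and pos: "\<And>w. w \<in> W ` space M \<Longrightarrow> 0 < q w"
    and le1: "(\<Sum>w\<in>W ` space M. q w) \<le> 1"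
  shows "label_entropy M W \<le> (\<integral>x. - ln (q (W x)) \<partial>M)"
proof -
  define p where "p w = prob (W -` {w} \<inter> space M)" for w
  have fin: "finite (W ` space M)" using W by (simp add: simple_function_def)
  have meas: "W -` {w} \<inter> space M \<in> events" for w
    using W by (rule simple_functionD(2))
  have term_le: "p w * ln (q w) - p w * ln (p w) \<le> q w - p w" if "w \<in> W ` space M" for w
  proof (cases "p w = 0")
    case True
    then show ?thesis using pos[OF that] by simp
  next
    case False
    then have "0 < p w" by (simp add: p_def zero_less_measure_iff)
    then have "p w * ln (q w / p w) \<le> p w * (q w / p w - 1)"
      using pos[OF that] by (intro mult_left_mono ln_le_minus_one) auto
    then show ?thesis using \<open>0 < p w\<close> pos[OF that] by (simp add: ln_div right_diff_distrib)
  qed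
  have one: "(\<Sum>w\<in>W ` space M. p w) = 1"
  proof -
    have "(\<Sum>w\<in>W ` space M. p w) = prob (\<Union>w\<in>W ` space M. W -` {w} \<inter> space M)"
      unfolding p_def using fin meas
      by (subst finite_measure_finite_Union) (auto simp: disjoint_family_on_def)
    also have "(\<Union>w\<in>W ` space M. W -` {w} \<inter> space M) = space M" by auto
    finally show ?thesis by (simp add: prob_space)
  qed
  have int: "(\<integral>x. - ln (q (W x)) \<partial>M) = (\<Sum>w\<in>W ` space M. - ln (q w) * p w)"
  proof -
    have "(\<integral>x. - ln (q (W x)) \<partial>M)
        = (\<integral>x. (\<Sum>w\<in>W ` space M. - ln (q w) * indicator (W -` {w} \<inter> space M) x) \<partial>M)"
    proof (intro Bochner_Integration.integral_cong refl)
      fix x assume x: "x \<in> space M"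
      have "(\<Sum>w\<in>W ` space M. - ln (q w) * indicator (W -` {w} \<inter> space M) x)
          = (\<Sum>w\<in>W ` space M. if w = W x then - ln (q w) else 0)"
        using x by (intro sum.cong) (auto simp: indicator_def)
      then show "- ln (q (W x)) = (\<Sum>w\<in>W ` space M. - ln (q w) * indicator (W -` {w} \<inter> space M) x)"
        using x fin by simp
    qed
    also have "\<dots> = (\<Sum>w\<in>W ` space M. - ln (q w) * p w)"
      using meas by (subst Bochner_Integration.integral_sum) (auto simp: p_def emeasure_eq_measure)
    finally show ?thesis .
  qed
  have "(\<Sum>w\<in>W ` space M. p w * ln (q w) - p w * ln (p w)) \<le> (\<Sum>w\<in>W ` space M. q w - p w)"
    by (intro sum_mono term_le)
  then have "label_entropy M W \<le> (\<Sum>w\<in>W ` space M. - ln (q w) * p w)"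
    using le1 one by (simp add: sum_subtractf label_entropy_def p_def sum_negf mult.commute)
  then show ?thesis by (simp only: int)
qed

end

section \<open>Entropy functionals of an automorphism\<close>

lemma restrict_eq_iff: "(\<lambda>i\<in>I. f i) = (\<lambda>i\<in>I. g i) \<longleftrightarrow> (\<forall>i\<in>I. f i = g i)"
  by (metis restrict_apply' restrict_ext)

locale pmp_automorphism = prob_space M for M :: "'a measure" +
  fixes T :: "'a \<Rightarrow> 'a"
  assumes automorphism: "mp_automorphism M T"
begin

lemma bij_T: "bij_betw T (space M) (space M)"
  using automorphism by (simp add: mp_automorphism_def)

lemma measurable_T [measurable]: "T \<in> M \<rightarrow>\<^sub>M M"
  using automorphism by (simp add: mp_automorphism_def)

lemma T_space [simp]: "x \<in> space M \<Longrightarrow> T x \<in> space M"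
  using measurable_T by (rule measurable_space)

lemma measurable_T_funpow [measurable]: "T ^^ n \<in> M \<rightarrow>\<^sub>M M"
  by (induction n) (auto simp: id_def)

lemma T_funpow_space [simp]: "x \<in> space M \<Longrightarrow> (T ^^ n) x \<in> space M"
  by (induction n) auto

lemma prob_vimage_T: "A \<in> events \<Longrightarrow> prob (T -` A \<inter> space M) = prob A"
  using automorphism measure_distr[OF measurable_T, of A] by (simp add: mp_automorphism_def)

lemma measurable_int_iterate: "int_iterate M T i \<in> M \<rightarrow>\<^sub>M M"
proof (cases "0 \<le> i")
  case False
  have "the_inv_into (space M) T ^^ n \<in> M \<rightarrow>\<^sub>M M" for n
    using automorphism by (induction n) (auto simp: id_def mp_automorphism_def intro: measurable_comp)
  then show ?thesis using False by (simp add: int_iterate_def [abs_def])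
qed (simp add: int_iterate_def [abs_def])

lemma distr_T_funpow: "distr M M (T ^^ n) = M"
proof (induction n)
  case 0
  show ?case by (simp add: id_def)
next
  case (Suc n)
  have "distr M M (T ^^ Suc n) = distr (distr M M (T ^^ n)) M T"
    by (subst distr_distr) simp_all
  also have "\<dots> = M"
    using Suc automorphism by (simp add: mp_automorphism_def)
  finally show ?case .
qed

text \<open>
  Every point of the space is of the form \<open>(T ^^ n) x\<close>; on such points integer iterates down to
  \<open>- n\<close> are ordinary powers of \<open>T\<close>, which avoids calculations with the inverse.
\<close>

lemma int_iterate_funpow:
  assumes x: "x \<in> space M" and "0 \<le> int n + i"
  shows "int_iterate M T i ((T ^^ n) x) = (T ^^ nat (int n + i)) x"
proof (cases "0 \<le> i")
  case True
  then show ?thesis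
    by (simp add: int_iterate_def nat_add_distrib add.commute[of n] funpow_add)
next
  case False
  define S where "S = the_inv_into (space M) T"
  have inv: "(S ^^ m) ((T ^^ m) y) = y" if "y \<in> space M" for m y
    using that
  proof (induction m arbitrary: y)
    case (Suc m)
    have "(S ^^ Suc m) ((T ^^ Suc m) y) = S ((S ^^ m) ((T ^^ m) (T y)))"
      by (simp add: funpow_swap1)
    also have "\<dots> = S (T y)" using Suc by simp
    also have "\<dots> = y"
      using Suc.prems bij_T by (simp add: S_def the_inv_into_f_f bij_betw_def)
    finally show ?case .
  qed simp
  have n: "n = nat (- i) + nat (int n + i)" using False assms by linarith
  have "(T ^^ n) x = (T ^^ nat (- i)) ((T ^^ nat (int n + i)) x)"
    by (subst n) (simp add: funpow_add)
  then show ?thesis using False x by (simp add: int_iterate_def inv flip: S_def)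
qed

lemma T_funpow_onto:
  assumes "x \<in> space M"
  obtains y where "y \<in> space M" "x = (T ^^ n) y"
proof -
  have "(T ^^ n) ` space M = space M"
    using bij_betw_funpow[OF bij_T] by (simp add: bij_betw_def)
  then show ?thesis using assms that by (metis imageE)
qed

lemma int_iterate_space [simp]: "x \<in> space M \<Longrightarrow> int_iterate M T i x \<in> space M"
  using measurable_int_iterate by (rule measurable_space)

lemma int_iterate_cancel [simp]:
  assumes "x \<in> space M"
  shows "int_iterate M T i (int_iterate M T (- i) x) = x"
proof -
  obtain y where y: "y \<in> space M" "x = (T ^^ nat \<bar>i\<bar>) y"
    using assms by (rule T_funpow_onto)
  have "int_iterate M T (- i) x = (T ^^ nat (\<bar>i\<bar> - i)) y"
    using y by (simp add: int_iterate_funpow)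
  moreover have "int (nat (\<bar>i\<bar> - i)) + i = \<bar>i\<bar>" by simp
  ultimately show ?thesis using y int_iterate_funpow[of y "nat (\<bar>i\<bar> - i)" i] by simp
qed

lemma translate_label:
  "translate M T j (label_partition M F) = label_partition M (\<lambda>x. F (int_iterate M T (- j) x))"
proof -
  have c: "int_iterate M T (- j) (int_iterate M T j x) = x" if "x \<in> space M" for x
    using int_iterate_cancel[OF that, of "- j"] by simp
  have "int_iterate M T j ` (F -` {b} \<inter> space M)
      = (\<lambda>x. F (int_iterate M T (- j) x)) -` {b} \<inter> space M" for b
  proof (intro equalityI subsetI)
    fix x assume x: "x \<in> (\<lambda>x. F (int_iterate M T (- j) x)) -` {b} \<inter> space M"
    then show "x \<in> int_iterate M T j ` (F -` {b} \<inter> space M)"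
      by (intro image_eqI[of _ _ "int_iterate M T (- j) x"]) auto
  qed (auto simp: c)
  moreover have "(\<lambda>x. F (int_iterate M T (- j) x)) ` space M = F ` space M"
  proof (intro equalityI subsetI)
    fix b assume "b \<in> F ` space M"
    then obtain x where "x \<in> space M" "b = F x" by auto
    then show "b \<in> (\<lambda>x. F (int_iterate M T (- j) x)) ` space M"
      by (intro image_eqI[of _ _ "int_iterate M T j x"]) (simp_all add: c)
  qed auto
  ultimately show ?thesis
    by (simp add: translate_def label_partition_def image_image)
qed

lemma simple_function_comp_measurable:
  assumes F: "simple_function M F" and g: "g \<in> M \<rightarrow>\<^sub>M M"
  shows "simple_function M (\<lambda>x. F (g x))"
proof -
  have "(\<lambda>x. F (g x)) -` {b} \<inter> space M \<in> events" for b
  proof -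
    have "(\<lambda>x. F (g x)) -` {b} \<inter> space M = g -` (F -` {b} \<inter> space M) \<inter> space M"
      using measurable_space[OF g] by auto
    also have "\<dots> \<in> events"
      using simple_functionD(2)[OF F] by (intro measurable_sets[OF g])
    finally show ?thesis .
  qed
  moreover have "finite ((\<lambda>x. F (g x)) ` space M)"
    by (rule finite_subset[OF _ simple_functionD(1)[OF F]]) (use measurable_space[OF g] in auto)
  ultimately show ?thesis by (simp add: simple_function_def)
qed

lemma simple_function_comp_funpow:
  "simple_function M F \<Longrightarrow> simple_function M (\<lambda>x. F ((T ^^ n) x))"
  by (rule simple_function_comp_measurable[OF _ measurable_T_funpow])

lemma label_entropy_comp_funpow:
  assumes "simple_function M F"
  shows "label_entropy M (\<lambda>x. F ((T ^^ n) x)) = label_entropy M F"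
proof -
  have "(\<lambda>x. F ((T ^^ n) x)) ` space M = F ` space M"
    using bij_betw_funpow[OF bij_T, of n] by (auto simp: bij_betw_def simp flip: image_image)
  moreover have "prob ((\<lambda>x. F ((T ^^ n) x)) -` {b} \<inter> space M) = prob (F -` {b} \<inter> space M)" for b
  proof -
    have "prob (F -` {b} \<inter> space M) = measure (distr M M (T ^^ n)) (F -` {b} \<inter> space M)"
      by (simp add: distr_T_funpow)
    also have "\<dots> = prob ((T ^^ n) -` (F -` {b} \<inter> space M) \<inter> space M)"
      by (intro measure_distr simple_functionD(2)[OF assms] measurable_T_funpow)
    also have "(T ^^ n) -` (F -` {b} \<inter> space M) \<inter> space M
        = (\<lambda>x. F ((T ^^ n) x)) -` {b} \<inter> space M" by auto
    finally show ?thesis by simp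
  qed
  ultimately show ?thesis by (simp add: label_entropy_def)
qed

definition word :: "('a \<Rightarrow> 'b) \<Rightarrow> nat \<Rightarrow> 'a \<Rightarrow> nat \<Rightarrow> 'b" where
  "word F n x = (\<lambda>i\<in>{..<n}. F ((T ^^ i) x))"

lemma word_eq_iff: "word F n x = word F n y \<longleftrightarrow> (\<forall>i<n. F ((T ^^ i) x) = F ((T ^^ i) y))"
  by (auto simp: word_def restrict_eq_iff)

lemma simple_function_restrict:
  assumes I: "finite I" and F: "\<And>i. i \<in> I \<Longrightarrow> simple_function M (F i)"
  shows "simple_function M (\<lambda>x. \<lambda>i\<in>I. F i x)"
proof -
  have "finite ((\<lambda>x. \<lambda>i\<in>I. F i x) ` space M)"
    by (rule finite_subset[of _ "Pi\<^sub>E I (\<lambda>i. F i ` space M)"])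
       (use I F in \<open>auto intro!: finite_PiE simp: simple_function_def\<close>)
  moreover have "(\<lambda>x. \<lambda>i\<in>I. F i x) -` {(\<lambda>i\<in>I. F i y)} \<inter> space M \<in> events" for y
  proof -
    have "(\<lambda>x. \<lambda>i\<in>I. F i x) -` {(\<lambda>i\<in>I. F i y)} \<inter> space M
        = {x \<in> space M. \<forall>i\<in>I. x \<in> F i -` {F i y} \<inter> space M}"
      by (auto simp: restrict_eq_iff)
    also have "\<dots> \<in> events"
    proof (rule sets.sets_Collect_finite_All[OF _ I])
      show "{x \<in> space M. x \<in> F i -` {F i y} \<inter> space M} \<in> events" if "i \<in> I" for i
        using simple_functionD(2)[OF F[OF that], of "{F i y}"]
        by (simp add: Collect_conj_eq Int_commute vimage_def Int_left_commute)
    qed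
    finally show ?thesis .
  qed
  ultimately show ?thesis by (auto simp: simple_function_def)
qed

lemma simple_function_word:
  "simple_function M F \<Longrightarrow> simple_function M (word F n)"
  unfolding word_def [abs_def]
  by (intro simple_function_restrict simple_function_comp_funpow) auto

lemma common_refinement_eq_word:
  assumes "0 < n"
  shows "common_refinement ((\<lambda>i. translate M T (- int i) (label_partition M F)) ` {..<n})
       = label_partition M (word F n)"
proof -
  have "common_refinement ((\<lambda>i. translate M T (- int i) (label_partition M F)) ` {..<n})
      = common_refinement ((\<lambda>i. label_partition M (\<lambda>x. F ((T ^^ i) x))) ` {..<n})"
    by (simp add: translate_label int_iterate_def)
  also have "\<dots> = label_partition M (word F n)"
    unfolding word_def [abs_def] using assms by (intro common_refinement_label) auto
  finally show ?thesis .
qed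

lemma entropy_rate_label:
  assumes "(\<lambda>n. label_entropy M (word F n) / real n) \<longlonglongrightarrow> h"
  shows "entropy_rate M T (label_partition M F) = ereal h"
  unfolding entropy_rate_def
proof (rule limI, rule Lim_transform_eventually)
  show "(\<lambda>n. ereal (label_entropy M (word F n) / real n)) \<longlonglongrightarrow> ereal h"
    using assms by simp
  show "\<forall>\<^sub>F n in sequentially. ereal (label_entropy M (word F n) / real n) =
          ereal (partition_entropy M (common_refinement
            ((\<lambda>i. translate M T (- int i) (label_partition M F)) ` {..<n})) / real n)"
    using eventually_gt_at_top[of 0]
    by eventually_elim (simp add: common_refinement_eq_word partition_entropy_label)
qed

lemma F_functional_label:
  "F_functional M T (label_partition M F)
       = label_entropy M (\<lambda>x. (F x, F (T x))) - label_entropy M F"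
  by (simp add: F_functional_def translate_label join_label partition_entropy_label int_iterate_def)

lemma cond_partition_entropy_label:
  assumes "simple_function M F"
  shows "cond_partition_entropy M (label_partition M F) (translate M T (- 1) (label_partition M F))
       = F_functional M T (label_partition M F)"
  using label_entropy_comp_funpow[OF assms, of 1]
  by (simp add: cond_partition_entropy_def F_functional_def translate_label
      partition_entropy_label int_iterate_def)

text \<open>
  Composing with \<open>T ^^ n\<close> preserves entropy and moves the window \<open>{- n..n}\<close> to \<open>{0..2 * n}\<close>, so
  the ball refinement has the entropy of a word of length \<open>2 * n + 1\<close>, and its join with the
  preimage adds one more letter.
\<close>

lemma F_functional_ball:
  assumes F: "simple_function M F"
  shows "F_functional M T (ball_refinement M T n (label_partition M F))
       = label_entropy M (word F (2 * n + 2)) - label_entropy M (word F (2 * n + 1))"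
proof -
  define B where "B x = (\<lambda>j\<in>{- int n..int n}. F (int_iterate M T (- j) x))" for x
  have B: "ball_refinement M T n (label_partition M F) = label_partition M B"
    unfolding ball_refinement_def translate_label B_def [abs_def]
    by (intro common_refinement_label) auto
  have simple_B: "simple_function M B"
    unfolding B_def [abs_def]
  proof (intro simple_function_restrict)
    fix j assume "j \<in> {- int n..int n}"
    show "simple_function M (\<lambda>x. F (int_iterate M T (- j) x))"
      using F measurable_int_iterate by (rule simple_function_comp_measurable)
  qed simp
  have iter: "int_iterate M T (- j) ((T ^^ n) x) = (T ^^ nat (int n - j)) x"
    if "j \<in> {- int n..int n}" "x \<in> space M" for j x
    using that int_iterate_funpow[of x n "- j"] by simp
  have ball_iff: "B ((T ^^ n) x) = B ((T ^^ n) y) \<longleftrightarrow> (\<forall>i<2 * n + 1. F ((T ^^ i) x) = F ((T ^^ i) y))"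
    if "x \<in> space M" "y \<in> space M" for x y
  proof -
    have "B ((T ^^ n) x) = B ((T ^^ n) y) \<longleftrightarrow>
        (\<forall>j\<in>{- int n..int n}. F ((T ^^ nat (int n - j)) x) = F ((T ^^ nat (int n - j)) y))"
      using that by (simp add: B_def restrict_eq_iff iter)
    also have "\<dots> \<longleftrightarrow> (\<forall>i\<in>(\<lambda>j. nat (int n - j)) ` {- int n..int n}. F ((T ^^ i) x) = F ((T ^^ i) y))"
      by simp
    also have "(\<lambda>j. nat (int n - j)) ` {- int n..int n} = {..<2 * n + 1}"
    proof (intro equalityI subsetI)
      fix i assume "i \<in> {..<2 * n + 1}"
      then show "i \<in> (\<lambda>j. nat (int n - j)) ` {- int n..int n}"
        by (intro image_eqI[of _ _ "int n - int i"]) auto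
    qed auto
    finally show ?thesis by auto
  qed
  have "label_entropy M B = label_entropy M (word F (2 * n + 1))"
    using label_entropy_comp_funpow[OF simple_B, of n]
      label_entropy_cong[of M "\<lambda>x. B ((T ^^ n) x)" "word F (2 * n + 1)"]
    by (simp add: ball_iff word_eq_iff)
  moreover have "label_entropy M (\<lambda>x. (B x, B (T x))) = label_entropy M (word F (2 * n + 2))"
  proof -
    have "simple_function M (\<lambda>x. (B x, B (T x)))"
      using simple_B simple_function_comp_funpow[OF simple_B, of 1]
      by (intro simple_function_Pair) auto
    then have "label_entropy M (\<lambda>x. (B x, B (T x)))
        = label_entropy M (\<lambda>x. (B ((T ^^ n) x), B (T ((T ^^ n) x))))"
      by (rule label_entropy_comp_funpow[symmetric])
    also have "label_entropy M (\<lambda>x. (B ((T ^^ n) x), B (T ((T ^^ n) x)))) = label_entropy M (word F (2 * n + 2))"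
    proof (rule label_entropy_cong)
      fix x y assume xy: "x \<in> space M" "y \<in> space M"
      have "(\<forall>i<2 * n + 2. P i) \<longleftrightarrow> (\<forall>i<2 * n + 1. P i) \<and> (\<forall>i<2 * n + 1. P (Suc i))" for P
      proof (intro iffI allI impI)
        fix i assume "(\<forall>i<2 * n + 1. P i) \<and> (\<forall>i<2 * n + 1. P (Suc i))" "i < 2 * n + 2"
        then show "P i" by (cases i) auto
      qed auto
      then show "((B ((T ^^ n) x), B (T ((T ^^ n) x))) = (B ((T ^^ n) y), B (T ((T ^^ n) y))))
          \<longleftrightarrow> word F (2 * n + 2) x = word F (2 * n + 2) y"
        using ball_iff[OF xy] ball_iff[of "T x" "T y"] xy
        by (simp add: word_eq_iff funpow_swap1)
    qed
    finally show ?thesis .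
  qed
  ultimately show ?thesis
    by (simp add: B F_functional_label)
qed

lemma label_entropy_word_mono:
  assumes "simple_function M F" "m \<le> n"
  shows "label_entropy M (word F m) \<le> label_entropy M (word F n)"
proof (rule label_entropy_mono)
  show "simple_function M (word F n)" using assms(1) by (rule simple_function_word)
  show "word F m x = (\<lambda>i\<in>{..<m}. word F n x i)" for x
    using assms(2) by (simp add: word_def restrict_eq_iff)
qed

text \<open>
  If every increment from \<open>2 * n + 1\<close> to \<open>2 * n + 2\<close> exceeded some \<open>c > 0\<close>, monotonicity would make
  the word entropies grow at rate at least \<open>c / 2\<close>.
\<close>

lemma f_functional_eq_0:
  assumes F: "simple_function M F"
    and lim: "(\<lambda>n. label_entropy M (word F n) / real n) \<longlonglongrightarrow> 0"
  shows "f_functional M T (label_partition M F) = 0"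
proof -
  define h where "h n = label_entropy M (word F n)" for n
  have mono: "h m \<le> h n" if "m \<le> n" for m n
    unfolding h_def using F that by (rule label_entropy_word_mono)
  have f: "f_functional M T (label_partition M F) = (INF n\<in>{1..}. ereal (h (2 * n + 2) - h (2 * n + 1)))"
    unfolding f_functional_def by (simp add: F_functional_ball[OF F] h_def)
  have "(INF n\<in>{1..}. ereal (h (2 * n + 2) - h (2 * n + 1))) \<le> ereal c" if c: "0 < c" for c
  proof -
    have "\<exists>n\<ge>1. h (2 * n + 2) - h (2 * n + 1) \<le> c"
    proof (rule ccontr)
      assume "\<not> ?thesis"
      then have "\<not> h (2 * n + 2) - h (2 * n + 1) \<le> c" if "n \<ge> 1" for n
        using that by blast
      then have gt: "h (2 * n + 1) + c < h (2 * n + 2)" if "n \<ge> 1" for n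
        using that by (simp add: not_le algebra_simps)
      have growth: "c * real n \<le> h (2 * (n + 1))" for n
      proof (induction n)
        case 0
        show ?case by (simp add: h_def label_entropy_nonneg)
      next
        case (Suc n)
        then show ?case
          using gt[of "Suc n"] mono[of "2 * (n + 1)" "2 * Suc n + 1"]
          by (simp add: algebra_simps)
      qed
      have lim_h: "(\<lambda>n. h (2 * (n + 1)) / real (2 * (n + 1))) \<longlonglongrightarrow> 0"
        using LIMSEQ_subseq_LIMSEQ[OF lim, of "\<lambda>n. 2 * (n + 1)"]
        by (simp add: h_def o_def strict_mono_def)
      have lim_c: "(\<lambda>n. c * real n / real (2 * (n + 1))) \<longlonglongrightarrow> c / 2"
        by real_asymp
      have "c / 2 \<le> 0"
      proof (rule LIMSEQ_le[OF lim_c lim_h], intro exI[of _ 0] allI impI)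
        show "c * real n / real (2 * (n + 1)) \<le> h (2 * (n + 1)) / real (2 * (n + 1))" for n
          by (intro divide_right_mono growth) simp
      qed
      then show False using c by simp
    qed
    then obtain n where n: "n \<ge> 1" "h (2 * n + 2) - h (2 * n + 1) \<le> c" by blast
    then show ?thesis by (intro INF_lower2[of n]) auto
  qed
  then have "(INF n\<in>{1..}. ereal (h (2 * n + 2) - h (2 * n + 1))) \<le> 0"
    using ereal_le_epsilon2[of "INF n\<in>{1..}. ereal (h (2 * n + 2) - h (2 * n + 1))" 0] by simp
  moreover have "0 \<le> (INF n\<in>{1..}. ereal (h (2 * n + 2) - h (2 * n + 1)))"
    by (intro INF_greatest) (simp add: mono)
  ultimately show ?thesis unfolding f by (rule antisym)
qed

lemma ks_entropy_eq_0:
  assumes "\<And>F :: 'a \<Rightarrow> 'a set. simple_function M F \<Longrightarrow>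
    (\<lambda>n. label_entropy M (word F n) / real n) \<longlonglongrightarrow> 0"
  shows "ks_entropy M T = 0"
proof -
  have "entropy_rate M T P = 0" if "finite_partition M P" for P
    using that
  proof (rule finite_partition_has_label)
    fix F :: "'a \<Rightarrow> 'a set" assume "simple_function M F" "P = label_partition M F"
    then show ?thesis using entropy_rate_label[OF assms] by (simp add: zero_ereal_def)
  qed
  moreover have "{P. finite_partition M P} \<noteq> {}"
    using finite_partition_label[of M "\<lambda>_. ()"] by auto
  ultimately show ?thesis by (simp add: ks_entropy_def)
qed

end

section \<open>The dyadic odometer\<close>

text \<open>
  The number \<open>d k x\<close> stands for the residue of \<open>x\<close> mod \<open>2 ^ k\<close>. The assumptions speak of residues
  instead of digit sequences so that the carrier can be any set that has room for the model.
\<close>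

locale odometer = prob_space M for M :: "'a measure" +
  fixes T :: "'a \<Rightarrow> 'a" and d :: "nat \<Rightarrow> 'a \<Rightarrow> nat"
  assumes space_eq_UNIV [simp]: "space M = UNIV"
    and bij: "bij T"
    and sets_eq: "sets M = sigma_sets UNIV {d k -` {i} | k i. True}"
    and prob_cell: "\<And>k i. i < 2 ^ k \<Longrightarrow> prob (d k -` {i}) = 1 / 2 ^ k"
    and d_less [simp]: "\<And>k x. d k x < 2 ^ k"
    and d_Suc_mod: "\<And>k x. d (Suc k) x mod 2 ^ k = d k x"
    and d_T: "\<And>k x. d k (T x) = (d k x + 1) mod 2 ^ k"
begin

lemma d_mod:
  assumes "k \<le> l"
  shows "d l x mod 2 ^ k = d k x"
  using assms
proof (induction l rule: dec_induct)
  case base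
  show ?case by simp
next
  case (step l)
  have "d (Suc l) x mod 2 ^ k = d (Suc l) x mod 2 ^ l mod 2 ^ k"
    using step.hyps by (simp add: mod_mod_cancel le_imp_power_dvd)
  then show ?case using step.IH by (simp add: d_Suc_mod)
qed

lemma d_T_funpow: "d k ((T ^^ n) x) = (d k x + n) mod 2 ^ k"
  by (induction n) (simp_all add: d_T mod_simps mod_Suc_eq)

lemma cell_vimage_eq: "d k -` S = (\<Union>i\<in>S \<inter> {..<2 ^ k}. d k -` {i})"
  by auto

lemma cell_event: "d k -` S \<in> events"
proof -
  have "d k -` {i} \<in> events" for i
    unfolding sets_eq by (intro sigma_sets.Basic) auto
  then have "(\<Union>i\<in>S \<inter> {..<2 ^ k}. d k -` {i}) \<in> events"
    by (intro sets.finite_UN) auto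
  then show ?thesis by (subst cell_vimage_eq)
qed

lemma simple_function_d: "simple_function M (d k)"
proof -
  have "finite (range (d k))" by (rule finite_subset[of _ "{..<2 ^ k}"]) auto
  then show ?thesis by (auto simp: simple_function_def cell_event)
qed

lemma prob_cells: "prob (d k -` S) = real (card (S \<inter> {..<2 ^ k})) / 2 ^ k"
proof -
  have "prob (d k -` S) = (\<Sum>i\<in>S \<inter> {..<2 ^ k}. prob (d k -` {i}))"
    by (subst cell_vimage_eq, intro finite_measure_finite_Union)
       (auto simp: disjoint_family_on_def cell_event)
  also have "\<dots> = (\<Sum>i\<in>S \<inter> {..<2 ^ k}. 1 / 2 ^ k)"
    by (intro sum.cong) (auto simp: prob_cell)
  finally show ?thesis by simp
qed

lemma vimage_T_cells: "T -` (d k -` S) = d k -` {j. (j + 1) mod 2 ^ k \<in> S}"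
  by (auto simp: d_T)

lemma succ_mod_eq_iff:
  fixes i j N :: nat
  assumes "i < N" "j < N"
  shows "(j + 1) mod N = i \<longleftrightarrow> j = (i + (N - 1)) mod N"
proof -
  have "(j + 1) mod N = (if j + 1 = N then 0 else j + 1)" using assms by auto
  moreover have "(i + (N - 1)) mod N = (if i = 0 then N - 1 else i - 1)"
  proof (cases i)
    case (Suc m)
    then have "i + (N - 1) = m + N" using assms by simp
    then show ?thesis using Suc assms by simp
  qed (use assms in simp)
  ultimately show ?thesis using assms by auto
qed

lemma measurable_odometer: "T \<in> M \<rightarrow>\<^sub>M M"
proof (rule measurable_sigma_sets[OF sets_eq])
  fix A assume "A \<in> {d k -` {i} | k i. True}"
  then show "T -` A \<inter> space M \<in> events" by (auto simp: vimage_T_cells cell_event simp del: vimage_Collect_eq)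
qed auto

lemma measurable_odometer_inverse: "the_inv_into UNIV T \<in> M \<rightarrow>\<^sub>M M"
proof (rule measurable_sigma_sets[OF sets_eq])
  fix A assume "A \<in> {d k -` {i} | k i. True}"
  then obtain k i where A: "A = d k -` {i}" by blast
  have "d k (the_inv_into UNIV T x) = (d k x + (2 ^ k - 1)) mod 2 ^ k" for x
  proof -
    have "T (the_inv_into UNIV T x) = x"
      using bij by (intro f_the_inv_into_f_bij_betw) auto
    then have "(d k (the_inv_into UNIV T x) + 1) mod 2 ^ k = d k x"
      by (metis d_T)
    then show ?thesis by (subst (asm) succ_mod_eq_iff) auto
  qed
  then have "the_inv_into UNIV T -` A \<inter> space M = d k -` {j. (j + (2 ^ k - 1)) mod 2 ^ k = i}"
    by (auto simp: A)
  then show "the_inv_into UNIV T -` A \<inter> space M \<in> events"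
    by (simp add: cell_event del: vimage_Collect_eq)
qed auto

lemma prob_vimage_cell: "prob (T -` (d k -` {i})) = prob (d k -` {i})"
proof (cases "i < 2 ^ k")
  case True
  have "d k (T x) = i \<longleftrightarrow> d k x = (i + (2 ^ k - 1)) mod 2 ^ k" for x
    unfolding d_T using True d_less by (rule succ_mod_eq_iff)
  then have "T -` (d k -` {i}) = d k -` {(i + (2 ^ k - 1)) mod 2 ^ k}"
    by auto
  then show ?thesis using True by (simp add: prob_cell)
next
  case False
  then have "d k -` {i} = {}" using d_less[of k] by auto
  then show ?thesis by simp
qed

text \<open>Residue classes of two levels are nested or disjoint.\<close>

lemma Int_stable_cells: "Int_stable {d k -` {i} | k i. True}"
proof (rule Int_stableI)
  have le: "d k -` {i} \<inter> d l -` {j} \<in> {d k -` {i} | k i. True}" if "k \<le> l" for k l i j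
  proof (cases "j mod 2 ^ k = i")
    case True
    then have "d k -` {i} \<inter> d l -` {j} = d l -` {j}"
      using d_mod[OF that] by auto
    then show ?thesis by auto
  next
    case False
    then have "d k -` {i} \<inter> d l -` {j} = {}"
      using d_mod[OF that] by auto
    \<comment> \<open>\<open>d 0\<close> is identically \<open>0\<close>, so the empty set occurs among the generators.\<close>
    also have "\<dots> = d 0 -` {1}"
      using d_less[of 0] by auto
    finally show ?thesis by auto
  qed
  fix A B assume "A \<in> {d k -` {i} | k i. True}" "B \<in> {d k -` {i} | k i. True}"
  then obtain k i l j where "A = d k -` {i}" "B = d l -` {j}" by blast
  then show "A \<inter> B \<in> {d k -` {i} | k i. True}"
    using le[of k l i j] le[of l k j i] by (cases "k \<le> l") (auto simp: Int_commute)
qed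

lemma distr_odometer: "distr M M T = M"
proof (rule measure_eqI_generator_eq[where A = "\<lambda>_. UNIV" and \<Omega> = UNIV])
  show "Int_stable {d k -` {i} | k i. True}" by (rule Int_stable_cells)
  show "emeasure (distr M M T) X = emeasure M X" if "X \<in> {d k -` {i} | k i. True}" for X
    using that
    by (auto simp: emeasure_distr[OF measurable_odometer] cell_event emeasure_eq_measure prob_vimage_cell)
  have "UNIV = d 0 -` {0}" using d_less[of 0] by auto
  then show "range (\<lambda>_. UNIV) \<subseteq> {d k -` {i} | k i. True}" by auto
  show "emeasure (distr M M T) UNIV \<noteq> \<infinity>"
    using emeasure_distr[OF measurable_odometer, of UNIV] sets.top[of M] by (simp add: emeasure_eq_measure)
qed (auto simp: sets_eq)

sublocale pmp_automorphism M T
  by unfold_locales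
     (use bij measurable_odometer measurable_odometer_inverse distr_odometer
       in \<open>simp add: mp_automorphism_def\<close>)

text \<open>
  The sets with this property form a \<open>\<sigma>\<close>-algebra: a countable union is first cut off to a finite
  one, whose finitely many approximations can be expressed at a common level.
\<close>

lemma approximate_by_cells:
  assumes "A \<in> events" "0 < e"
  shows "\<exists>k S. prob (sym_diff A (d k -` S)) < e"
proof -
  have "A \<in> sigma_sets UNIV {d k -` {i} | k i. True}"
    using assms(1) sets_eq by simp
  then have "\<forall>e>0. \<exists>k S. prob (sym_diff A (d k -` S)) < e"
  proof induction
    case (Basic a)
    then obtain k i where "a = d k -` {i}" by blast
    then show ?case by (intro allI impI exI[of _ k] exI[of _ "{i}"]) simp
  next
    case Empty
    show ?case by (intro allI impI exI[of _ 0] exI[of _ "{}"]) simp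
  next
    case (Compl a)
    have "sym_diff (UNIV - a) (d k -` (- S)) = sym_diff a (d k -` S)" for k S
      by auto
    then show ?case using Compl.IH by metis
  next
    case (Union a)
    have a: "a i \<in> events" for i using Union.hyps by (simp add: sets_eq)
    show ?case
    proof (intro allI impI)
      fix e :: real assume e: "0 < e"
      define U where "U n = (\<Union>i<n. a i)" for n
      have U: "U n \<in> events" for n unfolding U_def using a by auto
      have "(\<Union>n. U n) = (\<Union>i. a i)" by (auto simp: U_def)
      moreover have "incseq U" unfolding U_def incseq_def by (intro allI impI UN_mono) auto
      ultimately have lim: "(\<lambda>n. prob (U n)) \<longlonglongrightarrow> prob (\<Union>i. a i)"
        using finite_Lim_measure_incseq[of U] U by (simp add: image_subset_iff)
      obtain N where "\<And>n. n \<ge> N \<Longrightarrow> norm (prob (U n) - prob (\<Union>i. a i)) < e / 2"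
        using LIMSEQ_D[OF lim half_gt_zero[OF e]] by blast
      then have N: "\<bar>prob (U N) - prob (\<Union>i. a i)\<bar> < e / 2" by simp
      have Ua: "(\<Union>i. a i) \<in> events" using a by auto
      have tail: "prob ((\<Union>i. a i) - U N) < e / 2"
      proof -
        have "prob ((\<Union>i. a i) - U N) = prob (\<Union>i. a i) - prob (U N)"
          by (rule finite_measure_Diff[OF Ua U]) (auto simp: U_def)
        then show ?thesis using N by linarith
      qed
      have "\<forall>i. \<exists>k S. prob (sym_diff (a i) (d k -` S)) < e / (2 * (N + 1))"
        using Union.IH e by simp
      then obtain k S where kS: "\<And>i. prob (sym_diff (a i) (d (k i) -` S i)) < e / (2 * (N + 1))"
        by metis
      define K where "K = Max (insert 0 (k ` {..<N}))"
      define R where "R = {c. \<exists>i<N. c mod 2 ^ k i \<in> S i}"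
      have "k i \<le> K" if "i < N" for i using that by (auto simp: K_def)
      then have R: "d K -` R = (\<Union>i<N. d (k i) -` S i)"
        by (auto simp: R_def d_mod)
      have sd: "sym_diff (a i) (d (k i) -` S i) \<in> events" for i
        using a cell_event by auto
      have "prob (sym_diff (\<Union>i. a i) (d K -` R))
          \<le> prob (((\<Union>i. a i) - U N) \<union> (\<Union>i<N. sym_diff (a i) (d (k i) -` S i)))"
      proof (rule finite_measure_mono)
        show "sym_diff (\<Union>i. a i) (d K -` R)
            \<subseteq> ((\<Union>i. a i) - U N) \<union> (\<Union>i<N. sym_diff (a i) (d (k i) -` S i))"
          unfolding R U_def by blast
        show "((\<Union>i. a i) - U N) \<union> (\<Union>i<N. sym_diff (a i) (d (k i) -` S i)) \<in> events"
          using Ua U sd by blast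
      qed
      also have "\<dots> \<le> prob ((\<Union>i. a i) - U N) + prob (\<Union>i<N. sym_diff (a i) (d (k i) -` S i))"
        by (rule measure_Un_le) (use Ua U sd in blast)+
      also have "prob (\<Union>i<N. sym_diff (a i) (d (k i) -` S i))
          \<le> (\<Sum>i<N. prob (sym_diff (a i) (d (k i) -` S i)))"
        using sd by (intro finite_measure_subadditive_finite) auto
      also have "\<dots> \<le> (\<Sum>i<N. e / (2 * (N + 1)))"
        by (intro sum_mono less_imp_le kS)
      also have "\<dots> \<le> e / 2"
        using e by (simp add: field_simps)
      finally show "\<exists>k S. prob (sym_diff (\<Union>i. a i) (d k -` S)) < e"
        using tail by (intro exI[of _ K] exI[of _ R]) simp
    qed
  qed
  then show ?thesis using assms(2) by blast
qed

text \<open>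
  An invariant set meets all residue classes of one level in the same measure, hence is independent
  of every union of classes; approximating the set by such unions makes it independent of itself.
\<close>

lemma ergodic_odometer: "ergodic M T"
  unfolding ergodic_def
proof (intro ballI impI)
  fix A assume A: "A \<in> events" and "T -` A \<inter> space M = A"
  then have inv: "T x \<in> A \<longleftrightarrow> x \<in> A" for x by auto
  have step: "prob (A \<inter> d k -` {i}) = prob (A \<inter> d k -` {Suc i})" if "Suc i < 2 ^ k" for k i
  proof -
    have "T -` (A \<inter> d k -` {Suc i}) \<inter> space M = A \<inter> d k -` {i}"
      using that succ_mod_eq_iff[OF that d_less] by (auto simp: inv d_T)
    then show ?thesis
      using prob_vimage_T[of "A \<inter> d k -` {Suc i}"] A cell_event by auto
  qed
  have const: "prob (A \<inter> d k -` {i}) = prob (A \<inter> d k -` {0})" if "i < 2 ^ k" for k i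
    using that by (induction i) (use step in auto)
  have split: "prob (A \<inter> d k -` S) = real (card (S \<inter> {..<2 ^ k})) * prob (A \<inter> d k -` {0})" for k S
  proof -
    have "A \<inter> d k -` S = (\<Union>i\<in>S \<inter> {..<2 ^ k}. A \<inter> d k -` {i})" by auto
    also have "prob \<dots> = (\<Sum>i\<in>S \<inter> {..<2 ^ k}. prob (A \<inter> d k -` {i}))"
      using A cell_event by (intro finite_measure_finite_Union) (auto simp: disjoint_family_on_def)
    also have "\<dots> = (\<Sum>i\<in>S \<inter> {..<2 ^ k}. prob (A \<inter> d k -` {0}))"
      by (rule sum.cong[OF refl], rule const) simp
    finally show ?thesis by simp
  qed
  have indep: "prob (A \<inter> d k -` S) = prob A * prob (d k -` S)" for k S
    using split[of k S] split[of k UNIV] by (simp add: prob_cells)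
  have "\<bar>prob A - prob A * prob A\<bar> \<le> 0 + e" if e: "0 < e" for e
  proof -
    obtain k S where kS: "prob (sym_diff A (d k -` S)) < e / 2"
      using approximate_by_cells[OF A, of "e / 2"] e by auto
    define B where "B = d k -` S"
    have B: "B \<in> events" by (simp add: B_def cell_event)
    have sd: "prob (sym_diff A B) = prob (A - B) + prob (B - A)"
      using A B by (intro finite_measure_Union) auto
    have split: "prob C = prob (C \<inter> D) + prob (C - D)" if "C \<in> events" "D \<in> events" for C D
    proof -
      have "prob ((C \<inter> D) \<union> (C - D)) = prob (C \<inter> D) + prob (C - D)"
        using that by (intro finite_measure_Union) auto
      then show ?thesis by (simp add: Un_Diff_Int Un_commute)
    qed
    have small: "prob (A - B) + prob (B - A) < e / 2"
      using kS sd by (simp add: B_def)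
    have pA: "prob A = prob A * prob B + prob (A - B)"
      using split[OF A B] indep[of k S] by (simp add: B_def)
    have pB: "prob B = prob A * prob B + prob (B - A)"
      using split[OF B A] indep[of k S] by (simp add: B_def Int_commute)
    have "\<bar>prob B - prob A\<bar> \<le> e / 2"
      using small pA pB measure_nonneg[of M "A - B"] measure_nonneg[of M "B - A"] by linarith
    moreover have "\<bar>prob A - prob A * prob B\<bar> \<le> e / 2"
      using small pA measure_nonneg[of M "A - B"] measure_nonneg[of M "B - A"] by linarith
    moreover have "\<bar>prob A * prob B - prob A * prob A\<bar> \<le> \<bar>prob B - prob A\<bar>"
    proof -
      have "\<bar>prob A * prob B - prob A * prob A\<bar> = prob A * \<bar>prob B - prob A\<bar>"
        by (simp add: abs_mult flip: right_diff_distrib)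
      also have "\<dots> \<le> \<bar>prob B - prob A\<bar>" by (intro mult_left_le_one_le) auto
      finally show ?thesis .
    qed
    ultimately show ?thesis by linarith
  qed
  then have "\<bar>prob A - prob A * prob A\<bar> \<le> 0" by (rule field_le_epsilon)
  then have "prob A * (1 - prob A) = 0" by (simp add: algebra_simps)
  then show "prob A = 0 \<or> prob A = 1" by simp
qed

section \<open>Zero entropy\<close>

lemma approximate_simple_function:
  assumes F: "simple_function M F" and e: "0 < e"
  obtains k and g :: "nat \<Rightarrow> 'b"
  where "prob {x. F x \<noteq> g (d k x)} \<le> e" "range g \<subseteq> range F"
proof -
  define V where "V = range F"
  have fin: "finite V" using F by (simp add: simple_function_def V_def)
  have Fv: "F -` {v} \<in> events" for v
    using simple_functionD(2)[OF F, of "{v}"] by simp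
  have card: "0 < card V" using fin by (auto simp: V_def card_gt_0_iff)
  have "\<exists>k S. prob (sym_diff (F -` {v}) (d k -` S)) < e / card V" for v
    by (rule approximate_by_cells) (use Fv e card in auto)
  then obtain k S where kS: "\<And>v. prob (sym_diff (F -` {v}) (d (k v) -` S v)) < e / card V"
    by metis
  define K where "K = Max (k ` V)"
  have k_le: "k v \<le> K" if "v \<in> V" for v using that fin by (auto simp: K_def)
  \<comment> \<open>The approximating sets \<open>S v\<close> may overlap or fail to cover. Any label whose set contains the
    residue will do, and any label at all if there is none: an error at \<open>x\<close> puts \<open>x\<close> in the
    symmetric difference for its own label or for the chosen one.\<close>
  define g where "g c = (if \<exists>v\<in>V. c mod 2 ^ k v \<in> S v
      then SOME v. v \<in> V \<and> c mod 2 ^ k v \<in> S v else F undefined)" for c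
  have g: "g c \<in> V \<and> c mod 2 ^ k (g c) \<in> S (g c)" if "\<exists>v\<in>V. c mod 2 ^ k v \<in> S v" for c
    using that someI_ex[of "\<lambda>v. v \<in> V \<and> c mod 2 ^ k v \<in> S v"] by (auto simp: g_def)
  have sd: "sym_diff (F -` {v}) (d (k v) -` S v) \<in> events" for v
    using Fv cell_event by auto
  have "{x. F x \<noteq> g (d K x)} \<subseteq> (\<Union>v\<in>V. sym_diff (F -` {v}) (d (k v) -` S v))"
  proof
    fix x assume x: "x \<in> {x. F x \<noteq> g (d K x)}"
    have FV: "F x \<in> V" by (simp add: V_def)
    show "x \<in> (\<Union>v\<in>V. sym_diff (F -` {v}) (d (k v) -` S v))"
    proof (cases "d (k (F x)) x \<in> S (F x)")
      case True
      then have "\<exists>v\<in>V. d K x mod 2 ^ k v \<in> S v"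
        using FV k_le by (auto simp: d_mod intro!: bexI[of _ "F x"])
      note g[OF this]
      then have "g (d K x) \<in> V" "d (k (g (d K x))) x \<in> S (g (d K x))"
        using k_le by (auto simp: d_mod)
      then show ?thesis using x by (intro UN_I[of "g (d K x)"]) auto
    next
      case False
      then show ?thesis using FV by (intro UN_I[of "F x"]) auto
    qed
  qed
  then have "prob {x. F x \<noteq> g (d K x)} \<le> prob (\<Union>v\<in>V. sym_diff (F -` {v}) (d (k v) -` S v))"
    using sd fin by (intro finite_measure_mono sets.finite_UN) auto
  also have "\<dots> \<le> (\<Sum>v\<in>V. prob (sym_diff (F -` {v}) (d (k v) -` S v)))"
    using sd fin by (intro finite_measure_subadditive_finite) auto
  also have "\<dots> \<le> (\<Sum>v\<in>V. e / card V)"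
    by (intro sum_mono less_imp_le kS)
  also have "\<dots> = e" using card by simp
  finally have "prob {x. F x \<noteq> g (d K x)} \<le> e" .
  moreover have "range g \<subseteq> V"
    using g by (auto simp: g_def V_def)
  ultimately show ?thesis using that by (simp add: V_def)
qed

text \<open>
  The code: choose a residue \<open>c\<close> of the starting point uniformly, and then let the \<open>i\<close>-th letter
  be \<open>g ((c + i) mod 2 ^ k)\<close> with probability \<open>1 - e\<close> and any given other label with probability
  \<open>e / m\<close>. The right-hand side bounds the expected code length of the actual word when the true
  residue is used: a letter costs \<open>- ln (1 - e)\<close> where the approximation is correct and
  \<open>ln (m / e)\<close> where it errs.
\<close>

lemma label_entropy_word_le:
  assumes F: "simple_function M F" and e: "0 < e" "e < 1"
    and g: "range g \<subseteq> range F" and err: "prob {x. F x \<noteq> g (d k x)} \<le> e"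
  defines "m \<equiv> card (range F)"
  shows "label_entropy M (word F n) \<le> k * ln 2 + n * (- ln (1 - e) + e * ln (m / e))"
proof -
  define V where "V = range F"
  have fin: "finite V" using F by (simp add: simple_function_def V_def)
  have m: "1 \<le> real m"
    using fin by (auto simp: V_def m_def Suc_le_eq card_gt_0_iff)
  define E where "E = {x. F x \<noteq> g (d k x)}"
  have E: "E \<in> events"
  proof -
    have "simple_function M (\<lambda>x. (F x, g (d k x)))"
      using simple_function_compose1[OF simple_function_d, of g] F
      by (intro simple_function_Pair) auto
    then have "(\<lambda>x. (F x, g (d k x))) -` {(a, b). a \<noteq> b} \<inter> space M \<in> events"
      by (rule simple_functionD(2))
    then show ?thesis by (simp add: E_def vimage_def)
  qed
  define \<kappa> where "\<kappa> a b = (if a = b then 1 - e else e / m)" for a b :: 'b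
  define q where "q w = (\<Sum>c<2 ^ k. (\<Prod>i<n. \<kappa> (w i) (g ((c + i) mod 2 ^ k))) / 2 ^ k)" for w :: "nat \<Rightarrow> 'b"
  have \<kappa>_pos: "0 < \<kappa> a b" for a b using e m by (auto simp: \<kappa>_def)
  have \<kappa>_sum: "(\<Sum>a\<in>V. \<kappa> a b) \<le> 1" if "b \<in> V" for b
  proof -
    have "(\<Sum>a\<in>V. \<kappa> a b) = (1 - e) + (\<Sum>a\<in>V - {b}. \<kappa> a b)"
      using fin that by (simp add: sum.remove[of V b] \<kappa>_def)
    also have "(\<Sum>a\<in>V - {b}. \<kappa> a b) = (\<Sum>a\<in>V - {b}. e / m)"
      by (intro sum.cong) (auto simp: \<kappa>_def)
    also have "\<dots> \<le> (\<Sum>a\<in>V. e / m)"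
      using fin e by (intro sum_mono2) auto
    also have "\<dots> = e" using m by (simp add: m_def V_def)
    finally show ?thesis by simp
  qed
  have q_sum: "(\<Sum>w\<in>Pi\<^sub>E {..<n} (\<lambda>_. V). q w) \<le> 1"
  proof -
    have "(\<Sum>w\<in>Pi\<^sub>E {..<n} (\<lambda>_. V). q w)
        = (\<Sum>c<2 ^ k. (\<Sum>w\<in>Pi\<^sub>E {..<n} (\<lambda>_. V). \<Prod>i<n. \<kappa> (w i) (g ((c + i) mod 2 ^ k))) / 2 ^ k)"
      unfolding q_def by (subst sum.swap) (simp add: sum_divide_distrib)
    also have "\<dots> = (\<Sum>c<2 ^ k. (\<Prod>i<n. \<Sum>a\<in>V. \<kappa> a (g ((c + i) mod 2 ^ k))) / 2 ^ k)"
      using fin by (subst prod_sum_PiE) auto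
    also have "\<dots> \<le> (\<Sum>c<(2 :: nat) ^ k. 1 / 2 ^ k)"
    proof (intro sum_mono divide_right_mono prod_le_1 conjI)
      show "(\<Sum>a\<in>V. \<kappa> a (g ((c + i) mod 2 ^ k))) \<le> 1" for c i
        by (rule \<kappa>_sum) (use g in \<open>auto simp: V_def\<close>)
      show "0 \<le> (\<Sum>a\<in>V. \<kappa> a (g ((c + i) mod 2 ^ k)))" for c i
        by (intro sum_nonneg less_imp_le \<kappa>_pos)
    qed simp
    also have "\<dots> = 1" by (simp add: card_lessThan)
    finally show ?thesis .
  qed
  have q_pos: "0 < q w" for w
    unfolding q_def by (intro sum_pos divide_pos_pos prod_pos \<kappa>_pos) (auto simp: lessThan_empty_iff)
  have word_in: "word F n x \<in> Pi\<^sub>E {..<n} (\<lambda>_. V)" for x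
    by (auto simp: word_def V_def)
  \<comment> \<open>\<open>u\<close> bounds the code length pointwise. The price \<open>- ln (1 - e)\<close> is charged at errors as well;
    being nonnegative, it only increases the bound.\<close>
  define u where "u x = k * ln 2 + (\<Sum>i<n. - ln (1 - e) + ln (m / e) * indicator E ((T ^^ i) x))" for x
  have ln_q: "- ln (q (word F n x)) \<le> u x" for x
  proof -
    define p where "p = (\<Prod>i<n. \<kappa> (F ((T ^^ i) x)) (g (d k ((T ^^ i) x))))"
    have p_pos: "0 < p" unfolding p_def by (intro prod_pos \<kappa>_pos)
    \<comment> \<open>Of the mixture \<open>q\<close>, keep only the component of the true residue \<open>c = d k x\<close>.\<close>
    have "p / 2 ^ k = (\<Prod>i<n. \<kappa> (word F n x i) (g ((d k x + i) mod 2 ^ k))) / 2 ^ k"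
      by (simp add: p_def word_def d_T_funpow)
    also have "\<dots> \<le> q (word F n x)"
      unfolding q_def
      by (rule member_le_sum[where f = "\<lambda>c. (\<Prod>i<n. \<kappa> (word F n x i) (g ((c + i) mod 2 ^ k))) / 2 ^ k"])
         (auto intro!: divide_nonneg_nonneg prod_nonneg simp: less_imp_le[OF \<kappa>_pos])
    finally have "p / 2 ^ k \<le> q (word F n x)" .
    then have "ln (p / 2 ^ k) \<le> ln (q (word F n x))"
      using p_pos q_pos by simp
    then have "- ln (q (word F n x)) \<le> k * ln 2 - ln p"
      using p_pos by (simp add: ln_div ln_realpow)
    also have "ln p = (\<Sum>i<n. ln (\<kappa> (F ((T ^^ i) x)) (g (d k ((T ^^ i) x)))))"
      unfolding p_def by (intro ln_prod) (use \<kappa>_pos in \<open>auto simp: less_le\<close>)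
    also have "k * ln 2 - \<dots> = k * ln 2 + (\<Sum>i<n. - ln (\<kappa> (F ((T ^^ i) x)) (g (d k ((T ^^ i) x)))))"
      by (simp add: sum_negf)
    also have "\<dots> \<le> u x"
      unfolding u_def
    proof (intro add_left_mono sum_mono)
      fix i
      have "- ln (e / m) = ln (m / e)" using e m by (simp add: ln_div)
      moreover have "ln (1 - e) \<le> 0" using e by simp
      ultimately show "- ln (\<kappa> (F ((T ^^ i) x)) (g (d k ((T ^^ i) x))))
          \<le> - ln (1 - e) + ln (m / e) * indicator E ((T ^^ i) x)"
        by (auto simp: \<kappa>_def E_def indicator_def)
    qed
    finally show ?thesis .
  qed
  have u_nonneg: "0 \<le> u x" for x
  proof -
    have "0 \<le> ln (m / e)" using e m by (intro ln_ge_zero) (auto simp: field_simps)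
    moreover have "ln (1 - e) \<le> 0" using e by simp
    ultimately show ?thesis
      unfolding u_def by (intro add_nonneg_nonneg sum_nonneg) (auto intro!: add_nonneg_nonneg simp: indicator_def)
  qed
  have vim: "(T ^^ i) -` E \<in> events" "prob ((T ^^ i) -` E) = prob E" for i
  proof -
    show "(T ^^ i) -` E \<in> events"
      using measurable_sets[OF measurable_T_funpow E, of i] by simp
    show "prob ((T ^^ i) -` E) = prob E"
      using measure_distr[OF measurable_T_funpow E, of i] by (simp add: distr_T_funpow)
  qed
  have ind: "(\<lambda>x. indicator E ((T ^^ i) x) :: real) = indicator ((T ^^ i) -` E)" for i
    by (auto simp: indicator_def fun_eq_iff)
  have int_ind: "integrable M (\<lambda>x. indicator E ((T ^^ i) x) :: real)"
    "(\<integral>x. indicator E ((T ^^ i) x) \<partial>M) = prob E" for i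
    unfolding ind using vim by (auto simp: emeasure_eq_measure)
  have int_u: "integrable M u"
    unfolding u_def [abs_def]
    by (intro Bochner_Integration.integrable_add Bochner_Integration.integrable_sum
        integrable_const integrable_mult_right int_ind)
  have "label_entropy M (word F n) \<le> (\<integral>x. - ln (q (word F n x)) \<partial>M)"
  proof (rule label_entropy_le_cross_entropy)
    show "simple_function M (word F n)" using F by (rule simple_function_word)
    show "0 < q w" for w by (rule q_pos)
    have "(\<Sum>w\<in>word F n ` space M. q w) \<le> (\<Sum>w\<in>Pi\<^sub>E {..<n} (\<lambda>_. V). q w)"
      using fin word_in q_pos by (intro sum_mono2 finite_PiE) (auto intro: less_imp_le)
    then show "(\<Sum>w\<in>word F n ` space M. q w) \<le> 1" using q_sum by simp
  qed
  also have "\<dots> \<le> (\<integral>x. u x \<partial>M)"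
    by (rule integral_mono'[OF int_u]) (use ln_q u_nonneg in auto)
  also have "\<dots> = k * ln 2 + (\<Sum>i<n. - ln (1 - e) + ln (m / e) * prob E)"
    unfolding u_def using int_ind
    by (simp add: Bochner_Integration.integral_add Bochner_Integration.integral_sum prob_space[simplified] del: sum_constant)
  also have "\<dots> \<le> k * ln 2 + (\<Sum>i<n. - ln (1 - e) + ln (m / e) * e)"
  proof (intro add_left_mono sum_mono mult_left_mono)
    show "prob E \<le> e" using err by (simp add: E_def)
    show "0 \<le> ln (m / e)" using e m by (intro ln_ge_zero) (auto simp: field_simps)
  qed
  finally show ?thesis by (simp add: mult.commute)
qed

lemma word_entropy_rate_0:
  assumes F: "simple_function M F"
  shows "(\<lambda>n. label_entropy M (word F n) / real n) \<longlonglongrightarrow> 0"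
proof (rule tendstoI)
  fix \<delta> :: real assume \<delta>: "0 < \<delta>"
  define m where "m = real (card (range F))"
  have "0 < m"
    using simple_functionD(1)[OF F] by (auto simp: m_def card_gt_0_iff)
  then have "((\<lambda>e. - ln (1 - e) + e * ln (m / e)) \<longlongrightarrow> 0) (at_right 0)"
    by real_asymp
  then have "\<forall>\<^sub>F e in at_right 0. - ln (1 - e) + e * ln (m / e) < \<delta> / 2"
    using \<delta> by (intro order_tendstoD) auto
  moreover have "\<forall>\<^sub>F e in at_right (0 :: real). 0 < e \<and> e < 1"
    using eventually_at_right_real[of 0 1] by (rule eventually_mono) simp_all
  ultimately have "\<forall>\<^sub>F e in at_right 0. 0 < e \<and> e < 1 \<and> - ln (1 - e) + e * ln (m / e) < \<delta> / 2"
    by eventually_elim auto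
  then obtain e where e: "0 < e" "e < 1" "- ln (1 - e) + e * ln (m / e) < \<delta> / 2"
    using eventually_happens'[of "at_right (0 :: real)"] by auto
  obtain k g where kg: "prob {x. F x \<noteq> g (d k x)} \<le> e" "range g \<subseteq> range F"
    using approximate_simple_function[OF F e(1)] by metis
  have "(\<lambda>n. k * ln 2 / real n) \<longlonglongrightarrow> 0" by real_asymp
  then have "\<forall>\<^sub>F n in sequentially. k * ln 2 / real n < \<delta> / 2"
    using \<delta> by (intro order_tendstoD) auto
  then show "\<forall>\<^sub>F n in sequentially. dist (label_entropy M (word F n) / real n) 0 < \<delta>"
    using eventually_gt_at_top[of 0]
  proof eventually_elim
    case (elim n)
    have "label_entropy M (word F n) / real n
        \<le> (k * ln 2 + n * (- ln (1 - e) + e * ln (m / e))) / n"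
      using label_entropy_word_le[OF F e(1,2) kg(2,1)] by (intro divide_right_mono) (auto simp: m_def)
    also have "\<dots> = k * ln 2 / n + (- ln (1 - e) + e * ln (m / e))"
      using elim by (simp add: add_divide_distrib)
    also have "\<dots> < \<delta>" using elim e by linarith
    finally show ?case using label_entropy_nonneg[of "word F n"] by simp
  qed
qed

section \<open>A two-set generator\<close>

text \<open>The residue class of \<open>-1\<close>, whose first \<open>k\<close> binary digits are all \<open>1\<close>.\<close>

definition ones :: "nat \<Rightarrow> 'a set" where
  "ones k = d k -` {2 ^ k - 1}"

text \<open>
  The first binary digit \<open>0\<close> of \<open>x\<close> is at position \<open>k\<close> exactly if \<open>x\<close> is in
  \<open>ones k - ones (Suc k)\<close>. No digit \<open>0\<close> at all (the point \<open>-1\<close>) counts as false.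
\<close>

definition toeplitz :: "'a \<Rightarrow> bool" where
  "toeplitz x \<longleftrightarrow> (\<exists>k. even k \<and> x \<in> ones k - ones (Suc k))"

lemma ones_antimono:
  assumes "k \<le> l"
  shows "ones l \<subseteq> ones k"
proof -
  have "ones (Suc k) \<subseteq> ones k" for k
  proof
    fix x assume "x \<in> ones (Suc k)"
    then have "d k x = (2 ^ Suc k - 1) mod 2 ^ k"
      using d_Suc_mod[of k x] by (simp add: ones_def)
    also have "(2 ^ Suc k - 1 :: nat) = 2 ^ k + (2 ^ k - 1)" by simp
    also have "\<dots> mod 2 ^ k = 2 ^ k - 1" by (subst mod_add_self1, rule mod_less) simp
    finally show "x \<in> ones k" by (simp add: ones_def)
  qed
  then show ?thesis using lift_Suc_antimono_le[of ones k l] assms by blast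
qed

lemma toeplitz_iff:
  assumes "x \<in> ones k - ones (Suc k)"
  shows "toeplitz x \<longleftrightarrow> even k"
proof -
  have "j = k" if "x \<in> ones j - ones (Suc j)" for j
    using that assms ones_antimono[of "Suc j" k] ones_antimono[of "Suc k" j]
    by (cases j k rule: linorder_cases) auto
  then show ?thesis using assms unfolding toeplitz_def by blast
qed

lemma simple_function_toeplitz: "simple_function M toeplitz"
proof -
  have "{x. toeplitz x} = (\<Union>k\<in>{k. even k}. ones k - ones (Suc k))"
    by (auto simp: toeplitz_def)
  also have "\<dots> \<in> events"
    by (intro sets.countable_UN') (auto simp: ones_def cell_event)
  finally have A: "{x. toeplitz x} \<in> events" .
  then have "space M - {x. toeplitz x} \<in> events" by (rule sets.compl_sets)
  then have "toeplitz -` {b} \<in> events" for b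
    using A by (cases b) (simp_all add: vimage_def Collect_neg_eq Compl_eq_Diff_UNIV)
  then show ?thesis by (auto simp: simple_function_def)
qed

lemma d_funpow_period:
  assumes "k \<le> l"
  shows "d k ((T ^^ (2 ^ l)) x) = d k x"
proof -
  obtain q :: nat where "2 ^ l = 2 ^ k * q"
    using le_imp_power_dvd[OF assms, of "2 :: nat"] by (auto simp: dvd_def)
  then show ?thesis by (simp add: d_T_funpow)
qed

text \<open>
  Adding \<open>2 ^ Suc k\<close> leaves the digits up to position \<open>k\<close> unchanged and flips the digit at position
  \<open>Suc k\<close>. If the digit at position \<open>k\<close> is \<open>0\<close>, both points carry the label \<open>even k\<close>. If it is \<open>1\<close>,
  one of the two points has its first \<open>0\<close> at position \<open>Suc k\<close> and carries the opposite label.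
\<close>

lemma ones_Suc_iff:
  assumes x: "x \<in> ones k"
  shows "x \<in> ones (Suc k) \<longleftrightarrow>
    \<not> (toeplitz x = even k \<and> toeplitz ((T ^^ (2 ^ Suc k)) x) = even k)"
proof -
  define y where "y = (T ^^ (2 ^ Suc k)) x"
  have same: "d j y = d j x" if "j \<le> Suc k" for j
    unfolding y_def using that by (rule d_funpow_period)
  show ?thesis
  proof (cases "x \<in> ones (Suc k)")
    case False
    then have "x \<in> ones k - ones (Suc k)" "y \<in> ones k - ones (Suc k)"
      using x same by (auto simp: ones_def)
    then have "toeplitz x = even k" "toeplitz y = even k"
      by (simp_all add: toeplitz_iff)
    then show ?thesis using False unfolding y_def by blast
  next
    case True
    then have y: "y \<in> ones (Suc k)" using same by (simp add: ones_def)
    show ?thesis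
    proof (cases "x \<in> ones (Suc (Suc k))")
      case False
      then show ?thesis using True toeplitz_iff[of x "Suc k"] by simp
    next
      case True2: True
      have "d (Suc (Suc k)) y = (2 ^ Suc (Suc k) - 1 + 2 ^ Suc k) mod 2 ^ Suc (Suc k)"
        using True2 by (simp add: y_def d_T_funpow ones_def)
      also have "(2 ^ Suc (Suc k) - 1 + 2 ^ Suc k :: nat) = 2 ^ Suc (Suc k) + (2 ^ Suc k - 1)"
        by simp
      also have "\<dots> mod 2 ^ Suc (Suc k) = 2 ^ Suc k - 1"
        by (subst mod_add_self1, intro mod_less less_imp_diff_less) simp
      also have "\<dots> \<noteq> 2 ^ Suc (Suc k) - 1"
        using zero_less_power[of "2 :: nat" k] unfolding power_Suc by linarith
      finally have "y \<notin> ones (Suc (Suc k))"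
        by (simp add: ones_def)
      then have "toeplitz y \<noteq> even k" using y toeplitz_iff[of y "Suc k"] by simp
      then show ?thesis using True unfolding y_def by blast
    qed
  qed
qed

lemma cell_eq_vimage_ones:
  assumes "i < 2 ^ k"
  shows "d k -` {i} = (T ^^ (2 ^ k - 1 - i)) -` ones k"
proof -
  define N :: nat where "N = 2 ^ k"
  have iff: "(c + (N - 1 - i)) mod N = N - 1 \<longleftrightarrow> c = i" if "c < N" "i < N" for c
  proof (cases "c \<le> i")
    case True
    then have "c + (N - 1 - i) < N" using that by simp
    then show ?thesis using True that by auto
  next
    case False
    then have *: "c + (N - 1 - i) = N + (c - 1 - i)" using that by arith
    have "(c + (N - 1 - i)) mod N = c - 1 - i"
      unfolding * using that by (subst mod_add_self1) simp
    then show ?thesis using False that by auto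
  qed
  have "(d k x + (N - 1 - i)) mod N = N - 1 \<longleftrightarrow> d k x = i" for x
    using assms by (intro iff) (simp_all add: N_def)
  then have "d k ((T ^^ (N - 1 - i)) x) = N - 1 \<longleftrightarrow> d k x = i" for x
    unfolding d_T_funpow N_def .
  then show ?thesis unfolding ones_def N_def by auto
qed

text \<open>
  By \<open>ones_Suc_iff\<close> the sets \<open>ones k\<close> are obtained from the two cells one after the other, and every
  other residue class is a preimage of one of them under a power of \<open>T\<close>.
\<close>

lemma sets_subset_invariant_sigma_algebra:
  assumes S: "invariant_sigma_algebra M T S" and lab: "label_partition M toeplitz \<subseteq> S"
  shows "events \<subseteq> S"
proof -
  interpret S: sigma_algebra UNIV S
    using S by (simp add: invariant_sigma_algebra_def)
  have vim: "(T ^^ n) -` B \<in> S" if "B \<in> S" for B n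
  proof (induction n)
    case (Suc n)
    have "(T ^^ Suc n) -` B = T -` ((T ^^ n) -` B)"
      by (auto simp: funpow_swap1)
    moreover have "T -` ((T ^^ n) -` B) \<in> S"
      using Suc S by (simp add: invariant_sigma_algebra_def)
    ultimately show ?case by (simp only:)
  qed (use that in simp)
  have label: "toeplitz -` {b} \<in> S" for b
  proof (cases "b \<in> range toeplitz")
    case True
    then show ?thesis using lab by (auto simp: label_partition_def)
  next
    case False
    then have "toeplitz -` {b} = {}" by auto
    then show ?thesis by simp
  qed
  have ones: "ones k \<in> S" for k
  proof (induction k)
    case 0
    have "ones 0 = UNIV" using d_less[of 0] by (auto simp: ones_def)
    then show ?case using S.top by simp
  next
    case (Suc k)
    have "ones (Suc k) = ones k - (toeplitz -` {even k} \<inter> (T ^^ (2 ^ Suc k)) -` (toeplitz -` {even k}))"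
      using ones_Suc_iff[of _ k] ones_antimono[of k "Suc k"] by auto
    also have "\<dots> \<in> S"
      using Suc vim[OF label] label by blast
    finally show ?case .
  qed
  have "d k -` {i} \<in> S" for k i
  proof (cases "i < 2 ^ k")
    case True
    then show ?thesis using vim[OF ones] by (simp only: cell_eq_vimage_ones)
  next
    case False
    then have "d k -` {i} = {}" using d_less[of k] by auto
    then show ?thesis by simp
  qed
  then show ?thesis
    unfolding sets_eq by (intro S.sigma_sets_subset) auto
qed

lemma generating_toeplitz: "generating M T (label_partition M toeplitz)"
  unfolding generating_def full_mod_null_def
proof (intro ballI bexI)
  fix A assume "A \<in> events"
  then show "A \<in> \<Inter> {S. invariant_sigma_algebra M T S \<and> label_partition M toeplitz \<subseteq> S}"
    using sets_subset_invariant_sigma_algebra by blast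
qed auto

section \<open>Partitions of staggered resolution\<close>

definition staggered :: "nat \<Rightarrow> 'a \<Rightarrow> nat" where
  "staggered n x = d (if even (d 1 x) then n else Suc n) x"

lemma even_d: "1 \<le> k \<Longrightarrow> even (d k x) \<longleftrightarrow> even (d 1 x)"
  using d_mod[of 1 k x] by (metis even_mod_2_iff power_one_right)

lemma even_staggered: "1 \<le> n \<Longrightarrow> even (staggered n x) \<longleftrightarrow> even (d 1 x)"
  using even_d[of n x] even_d[of "Suc n" x] by (simp add: staggered_def)

lemma staggered_mod: "staggered n x mod 2 ^ n = d n x"
  by (simp add: staggered_def d_Suc_mod)

lemma staggered_eq: "staggered n x =
    (if even (d (Suc n) x) then d (Suc n) x mod 2 ^ n else d (Suc n) x)"
  using even_d[of "Suc n" x] by (simp add: staggered_def d_Suc_mod)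

lemma simple_function_staggered: "simple_function M (staggered n)"
  using simple_function_compose1[OF simple_function_d[of "Suc n"],
      of "\<lambda>c. if even c then c mod 2 ^ n else c"]
  by (simp add: staggered_eq [abs_def])

text \<open>
  The parity of the label reveals the parity of the point, hence the level at which the label is a
  residue, so the coarser label is a function of the finer one.
\<close>

lemma staggered_refines:
  assumes "1 \<le> n"
  shows "refines_mod_null M (label_partition M (staggered (Suc n))) (label_partition M (staggered n))"
proof -
  have *: "staggered n x = staggered n y" if "staggered (Suc n) x = staggered (Suc n) y" for x y
  proof -
    have "staggered n x = (if even (staggered (Suc n) x) then staggered (Suc n) x mod 2 ^ n
        else staggered (Suc n) x mod 2 ^ Suc n)" for x
      using even_staggered[of "Suc n" x] by (simp add: staggered_def d_mod del: power_Suc)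
    then show ?thesis using that by metis
  qed
  show ?thesis
    unfolding refines_mod_null_def label_partition_eq_cells
  proof (intro ballI)
    fix A assume "A \<in> (\<lambda>x. {y \<in> space M. staggered (Suc n) y = staggered (Suc n) x}) ` space M"
    then obtain x where "A = {y \<in> space M. staggered (Suc n) y = staggered (Suc n) x}" by blast
    then have "A - {y \<in> space M. staggered n y = staggered n x} = {}"
      using * by blast
    then have "A - {y \<in> space M. staggered n y = staggered n x} \<in> null_sets M"
      by (simp only: null_sets.empty_sets)
    then show "\<exists>B\<in>(\<lambda>x. {y \<in> space M. staggered n y = staggered n x}) ` space M. A - B \<in> null_sets M"
      by (rule bexI) simp
  qed
qed

lemma staggered_generate:
  "full_mod_null M (sigma_sets (space M) (\<Union>n\<in>{1..}. label_partition M (staggered n)))"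
proof -
  define G where "G = (\<Union>n\<in>{1..}. label_partition M (staggered n))"
  interpret G: sigma_algebra UNIV "sigma_sets UNIV G"
    by (rule sigma_algebra_sigma_sets) auto
  have "d k -` {i} \<in> sigma_sets UNIV G" for k i
  proof (cases "k = 0")
    case True
    then have "d k -` {i} = (if i = 0 then UNIV else {})" using d_less[of 0] by auto
    then show ?thesis using G.top by auto
  next
    case False
    have "d k -` {i} = (\<Union>c\<in>{c \<in> range (staggered k). c mod 2 ^ k = i}. staggered k -` {c})"
      by (auto simp flip: staggered_mod)
    also have "\<dots> \<in> sigma_sets UNIV G"
    proof (intro G.finite_UN)
      show "finite {c \<in> range (staggered k). c mod 2 ^ k = i}"
        using simple_functionD(1)[OF simple_function_staggered[of k]] by simp
      show "staggered k -` {c} \<in> sigma_sets UNIV G"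
        if "c \<in> {c \<in> range (staggered k). c mod 2 ^ k = i}" for c
      proof (rule sigma_sets.Basic)
        have "staggered k -` {c} \<in> label_partition M (staggered k)"
          using that by (auto simp: label_partition_def)
        then show "staggered k -` {c} \<in> G" using False by (auto simp: G_def)
      qed
    qed
    finally show ?thesis .
  qed
  then have "events \<subseteq> sigma_sets UNIV G"
    unfolding sets_eq by (intro sigma_sets_mono) auto
  show ?thesis
    unfolding full_mod_null_def G_def[symmetric]
  proof (intro ballI)
    fix A assume "A \<in> events"
    with \<open>events \<subseteq> sigma_sets UNIV G\<close> show "\<exists>B\<in>sigma_sets (space M) G. sym_diff A B \<in> null_sets M"
      by (intro bexI[of _ A]) auto
  qed
qed

lemma label_entropy_d: "label_entropy M (d k) = k * ln 2"
proof -
  have "label_entropy M (d k) = - (\<Sum>i<2 ^ k. prob (d k -` {i}) * ln (prob (d k -` {i})))"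
    by (subst label_entropy_superset[of "{..<2 ^ k}"]) auto
  also have "\<dots> = - (\<Sum>i<(2 :: nat) ^ k. 1 / 2 ^ k * ln (1 / 2 ^ k))"
    by (intro arg_cong[of _ _ uminus] sum.cong) (auto simp: prob_cell)
  also have "\<dots> = k * ln 2"
    by (simp add: ln_div ln_realpow)
  finally show ?thesis .
qed

text \<open>
  The labels are the even residues mod \<open>2 ^ n\<close>, each of measure \<open>1 / 2 ^ n\<close>, and the odd residues
  mod \<open>2 ^ Suc n\<close>, each of measure \<open>1 / 2 ^ Suc n\<close>; each family has total measure \<open>1 / 2\<close>.
\<close>

lemma label_entropy_staggered:
  assumes "1 \<le> n"
  shows "label_entropy M (staggered n) = (n + 1 / 2) * ln 2"
proof -
  obtain m where n: "n = Suc m" using assms by (cases n) auto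
  define E where "E = (\<lambda>j :: nat. 2 * j) ` {..<2 ^ m}"
  define D where "D = (\<lambda>j :: nat. 2 * j + 1) ` {..<2 ^ n}"
  define \<phi> where "\<phi> c = prob (staggered n -` {c}) * ln (prob (staggered n -` {c}))" for c
  have "staggered n x \<in> E \<union> D" for x
  proof (cases "even (d 1 x)")
    case True
    then have "even (d n x)" "staggered n x = d n x" using even_d[OF assms, of x] by (simp_all add: staggered_def)
    then show ?thesis using d_less[of n x] by (auto simp: E_def n elim!: evenE)
  next
    case False
    then have "odd (d (Suc n) x)" "staggered n x = d (Suc n) x"
      using even_d[of "Suc n" x] by (simp_all add: staggered_def)
    then show ?thesis using d_less[of "Suc n" x] by (auto simp: D_def elim!: oddE)
  qed
  then have "label_entropy M (staggered n) = - (\<Sum>c\<in>E \<union> D. \<phi> c)"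
    using label_entropy_superset[of "E \<union> D" "staggered n"] by (auto simp: \<phi>_def E_def D_def)
  also have "(\<Sum>c\<in>E \<union> D. \<phi> c) = (\<Sum>c\<in>E. \<phi> c) + (\<Sum>c\<in>D. \<phi> c)"
    by (intro sum.union_disjoint) (auto simp: E_def D_def, presburger)
  also have "(\<Sum>c\<in>E. \<phi> c) = (\<Sum>c\<in>E. 1 / 2 ^ n * ln (1 / 2 ^ n))"
  proof (intro sum.cong refl)
    fix c assume "c \<in> E"
    then have c: "even c" "c < 2 ^ n" by (auto simp: E_def n)
    then have "staggered n -` {c} = d n -` {c}"
      using assms even_staggered[OF assms] even_d[OF assms] by (auto simp: staggered_def split: if_splits)
    then show "\<phi> c = 1 / 2 ^ n * ln (1 / 2 ^ n)" using c by (simp add: \<phi>_def prob_cell)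
  qed
  also have "(\<Sum>c\<in>D. \<phi> c) = (\<Sum>c\<in>D. 1 / 2 ^ Suc n * ln (1 / 2 ^ Suc n))"
  proof (intro sum.cong refl)
    fix c assume "c \<in> D"
    then have c: "odd c" "c < 2 ^ Suc n" by (auto simp: D_def)
    then have "staggered n -` {c} = d (Suc n) -` {c}"
      using even_staggered[OF assms] even_d[of "Suc n"] by (auto simp: staggered_def split: if_splits)
    then show "\<phi> c = 1 / 2 ^ Suc n * ln (1 / 2 ^ Suc n)" using c by (simp only: \<phi>_def prob_cell)
  qed
  also have "(\<Sum>c\<in>E. 1 / 2 ^ n * ln (1 / 2 ^ n)) = 2 ^ m * (1 / 2 ^ n * ln (1 / 2 ^ n) :: real)"
    unfolding E_def by (subst sum.reindex) (auto simp: inj_on_def)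
  also have "(\<Sum>c\<in>D. 1 / 2 ^ Suc n * ln (1 / 2 ^ Suc n)) = 2 ^ n * (1 / 2 ^ Suc n * ln (1 / 2 ^ Suc n) :: real)"
    unfolding D_def by (subst sum.reindex) (auto simp: inj_on_def)
  finally have "label_entropy M (staggered n)
      = - (2 ^ m * (1 / 2 ^ n * ln (1 / 2 ^ n)) + 2 ^ n * (1 / 2 ^ Suc n * ln (1 / 2 ^ Suc n)))" .
  moreover have "ln (1 / 2 ^ j :: real) = - (j * ln 2)" for j
    by (simp add: ln_div ln_realpow)
  ultimately have "label_entropy M (staggered n)
      = 2 ^ m * (1 / 2 ^ n * (n * ln 2)) + 2 ^ n * (1 / 2 ^ Suc n * (Suc n * ln 2))"
    by (simp only: mult_minus_right minus_add_distrib minus_minus)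
  also have "\<dots> = (n + 1 / 2) * ln 2"
    by (simp add: n field_simps)
  finally show ?thesis .
qed

text \<open>
  An odd point has its residue mod \<open>2 ^ Suc n\<close> as its own label. An even point has an odd successor,
  whose label is that residue plus \<open>1\<close>.
\<close>

lemma F_functional_staggered:
  assumes "1 \<le> n"
  shows "F_functional M T (label_partition M (staggered n)) = ln 2 / 2"
proof -
  have "label_entropy M (\<lambda>x. (staggered n x, staggered n (T x))) = label_entropy M (d (Suc n))"
  proof (rule label_entropy_cong)
    fix x y
    show "(staggered n x, staggered n (T x)) = (staggered n y, staggered n (T y))
        \<longleftrightarrow> d (Suc n) x = d (Suc n) y"
    proof
      assume eq: "(staggered n x, staggered n (T x)) = (staggered n y, staggered n (T y))"
      then have par: "even (d 1 x) \<longleftrightarrow> even (d 1 y)"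
        using even_staggered[OF assms] by (metis prod.inject)
      show "d (Suc n) x = d (Suc n) y"
      proof (cases "even (d 1 x)")
        case False
        then show ?thesis using eq par by (simp add: staggered_def)
      next
        case True
        have "odd (d 1 (T z))" if "even (d 1 z)" for z
          using that d_T[of 1 z] by (simp add: even_mod_2_iff)
        then have "d (Suc n) (T x) = d (Suc n) (T y)"
          using eq par True by (simp add: staggered_def)
        then have "(d (Suc n) x + 1) mod 2 ^ Suc n = (d (Suc n) y + 1) mod 2 ^ Suc n"
          by (simp only: d_T)
        moreover have "d (Suc n) z = ((d (Suc n) z + 1) mod 2 ^ Suc n + (2 ^ Suc n - 1)) mod 2 ^ Suc n" for z
          by (rule succ_mod_eq_iff[THEN iffD1]) (simp_all del: power_Suc)
        ultimately show ?thesis by metis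
      qed
    next
      assume "d (Suc n) x = d (Suc n) y"
      then show "(staggered n x, staggered n (T x)) = (staggered n y, staggered n (T y))"
        by (simp add: staggered_eq d_T)
    qed
  qed
  then show ?thesis
    using assms
    by (simp add: F_functional_label label_entropy_d label_entropy_staggered
        algebra_simps)
qed

end

section \<open>A model on the real line\<close>

definition coin :: "(nat \<Rightarrow> bool) measure" where
  "coin = (\<Pi>\<^sub>M i\<in>UNIV. measure_pmf (bernoulli_pmf (1 / 2)))"

text \<open>Addition of \<open>1\<close> with carry, the least significant digit first.\<close>

definition add_one :: "(nat \<Rightarrow> bool) \<Rightarrow> nat \<Rightarrow> bool" where
  "add_one x n \<longleftrightarrow> x n \<noteq> (\<forall>i<n. x i)"

definition low_bits :: "nat \<Rightarrow> (nat \<Rightarrow> bool) \<Rightarrow> nat" where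
  "low_bits k x = (\<Sum>i<k. of_bool (x i) * 2 ^ i)"

lemma low_bits_less: "low_bits k x < 2 ^ k"
  by (induction k) (auto simp: low_bits_def)

lemma low_bits_Suc: "low_bits (Suc k) x = low_bits k x + of_bool (x k) * 2 ^ k"
  by (simp add: low_bits_def)

lemma low_bits_Suc_mod: "low_bits (Suc k) x mod 2 ^ k = low_bits k x"
  using low_bits_less[of k x] by (simp add: low_bits_Suc)

lemma low_bits_eq_iff: "low_bits k x = low_bits k y \<longleftrightarrow> (\<forall>i<k. x i = y i)"
proof (induction k)
  case (Suc k)
  have "low_bits (Suc k) x = low_bits (Suc k) y \<longleftrightarrow> low_bits k x = low_bits k y \<and> x k = y k"
    using low_bits_less[of k x] low_bits_less[of k y]
    by (cases "x k"; cases "y k") (auto simp: low_bits_Suc)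
  then show ?case using Suc by (auto simp: less_Suc_eq)
qed (simp add: low_bits_def)

lemma low_bits_bit:
  assumes "i < 2 ^ k"
  shows "low_bits k (bit i) = i"
proof -
  have "low_bits k (bit i) = (\<Sum>j = 0..<k. push_bit j (of_bool (bit i j)))"
    by (simp add: low_bits_def push_bit_eq_mult lessThan_atLeast0)
  also have "\<dots> = take_bit k i" by (rule take_bit_sum[symmetric])
  also have "\<dots> = i" using assms by (rule take_bit_nat_eq_self)
  finally show ?thesis .
qed

lemma low_bits_add_one: "low_bits k (add_one x) = (low_bits k x + 1) mod 2 ^ k"
proof (induction k)
  case (Suc k)
  have carry: "(\<forall>i<k. x i) \<longleftrightarrow> low_bits k x + 1 = 2 ^ k"
  proof -
    have "low_bits k (\<lambda>_. True) + 1 = 2 ^ k"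
      by (induction k) (auto simp: low_bits_def)
    then show ?thesis using low_bits_eq_iff[of k x "\<lambda>_. True"] by auto
  qed
  show ?case
  proof (cases "\<forall>i<k. x i")
    case True
    then have p: "low_bits k x + 1 = 2 ^ k" and "add_one x k \<longleftrightarrow> \<not> x k"
      using carry by (auto simp: add_one_def)
    then have "low_bits (Suc k) (add_one x) = of_bool (\<not> x k) * 2 ^ k"
      unfolding low_bits_Suc Suc p by simp
    moreover have "low_bits (Suc k) x + 1 = 2 ^ k + of_bool (x k) * 2 ^ k"
      using p by (simp add: low_bits_Suc)
    ultimately show ?thesis by (cases "x k") (simp_all flip: mult_2)
  next
    case False
    then have p: "low_bits k x + 1 < 2 ^ k" and "add_one x k \<longleftrightarrow> x k"
      using carry low_bits_less[of k x] by (auto simp: add_one_def)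
    then show ?thesis by (cases "x k") (simp_all add: low_bits_Suc Suc)
  qed
qed (simp add: low_bits_def)

lemma bij_add_one: "bij add_one"
proof -
  define sub_one where "sub_one x n \<longleftrightarrow> x n \<noteq> (\<forall>i<n. \<not> x i)" for x :: "nat \<Rightarrow> bool" and n
  \<comment> \<open>The digits of \<open>x - 1\<close> below \<open>n\<close> are all \<open>1\<close> exactly if the subtraction borrows from digit \<open>n\<close>.\<close>
  have borrow: "(\<forall>i<n. sub_one x i) \<longleftrightarrow> (\<forall>i<n. \<not> x i)" for x n
  proof (induction n)
    case (Suc n)
    show ?case
      unfolding All_less_Suc Suc sub_one_def [of x n] by blast
  qed simp
  have carry: "(\<forall>i<n. \<not> add_one x i) \<longleftrightarrow> (\<forall>i<n. x i)" for x n
  proof (induction n)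
    case (Suc n)
    show ?case
      unfolding All_less_Suc Suc add_one_def [of x n] by blast
  qed simp
  have "add_one (sub_one x) = x" for x
  proof
    show "add_one (sub_one x) n = x n" for n
      unfolding add_one_def borrow sub_one_def [of x n] by blast
  qed
  moreover have "sub_one (add_one x) = x" for x
  proof
    show "sub_one (add_one x) n = x n" for n
      unfolding sub_one_def carry add_one_def [of x n] by blast
  qed
  ultimately show ?thesis by (metis bij_iff)
qed

lemma space_coin: "space coin = UNIV"
  by (simp add: coin_def space_PiM)

lemma prob_space_coin: "prob_space coin"
  unfolding coin_def by (intro prob_space_PiM measure_pmf.prob_space_axioms)

lemma low_bits_cell_eq:
  assumes "i < 2 ^ k"
  shows "low_bits k -` {i} = {x \<in> space coin. \<forall>j\<in>{..<k}. x j \<in> {bit i j}}"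
proof -
  have "low_bits k x = i \<longleftrightarrow> (\<forall>j<k. x j = bit i j)" for x
    using low_bits_eq_iff[of k x "bit i"] unfolding low_bits_bit[OF assms] .
  then show ?thesis unfolding space_coin vimage_def by (simp add: Ball_def)
qed

lemma prob_low_bits:
  assumes "i < 2 ^ k"
  shows "measure coin (low_bits k -` {i}) = 1 / 2 ^ k"
proof -
  interpret product_prob_space "\<lambda>_. measure_pmf (bernoulli_pmf (1 / 2))" "UNIV :: nat set" ..
  have half: "emeasure (measure_pmf (bernoulli_pmf (1 / 2))) {b} = ennreal (1 / 2)" for b
    by (cases b) (simp_all add: emeasure_pmf_single)
  have "emeasure coin (low_bits k -` {i}) = (\<Prod>j<k. ennreal (1 / 2))"
    unfolding low_bits_cell_eq[OF assms] coin_def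
    by (subst emeasure_PiM_Collect) (simp_all only: half, auto)
  also have "\<dots> = ennreal (1 / 2 ^ k)"
    by (simp only: prod_constant card_lessThan ennreal_power power_one_over)
  finally show ?thesis by (simp add: measure_def)
qed

lemma low_bits_cell_sets: "low_bits k -` {i} \<in> sets coin"
proof (cases "i < 2 ^ k")
  case True
  show ?thesis
    unfolding low_bits_cell_eq[OF True] coin_def
    by (intro sets.sets_Collect_finite_All sets_Collect_single') simp_all
next
  case False
  then have "low_bits k -` {i} = {}" using low_bits_less[of k] by auto
  then show ?thesis by simp
qed

lemma sets_coin: "sets coin = sigma_sets UNIV {low_bits k -` {i} | k i. True}"
proof
  have sets: "sets coin = sigma_sets UNIV {{x. x i \<in> A} | i A. True}"
    unfolding coin_def sets_PiM_single by (simp add: PiE_UNIV_domain)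
  interpret sigma_algebra UNIV "sigma_sets UNIV {low_bits k -` {i} | k i. True}"
    by (rule sigma_algebra_sigma_sets) auto
  show "sets coin \<subseteq> sigma_sets UNIV {low_bits k -` {i} | k i. True}"
    unfolding sets
  proof (rule sigma_sets_subset, safe)
    fix i :: nat and A :: "bool set"
    have "{x. x i \<in> A} = (\<Union>c\<in>low_bits (Suc i) ` {x. x i \<in> A}. low_bits (Suc i) -` {c})"
      by (auto simp: low_bits_eq_iff)
    also have "\<dots> \<in> sigma_sets UNIV {low_bits k -` {i} | k i. True}"
    proof (intro finite_UN)
      show "finite (low_bits (Suc i) ` {x. x i \<in> A})"
        by (rule finite_subset[of _ "{..<2 ^ Suc i}"]) (use low_bits_less[of "Suc i"] in auto)
    qed (auto intro: sigma_sets.Basic)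
    finally show "{x. x i \<in> A} \<in> sigma_sets UNIV {low_bits k -` {i} | k i. True}" .
  qed
  show "sigma_sets UNIV {low_bits k -` {i} | k i. True} \<subseteq> sets coin"
    using sets.sigma_sets_subset[of "{low_bits k -` {i} | k i. True}" coin] low_bits_cell_sets
    by (auto simp: space_coin)
qed

lemma odometer_coin: "odometer coin add_one low_bits"
proof -
  interpret prob_space coin by (rule prob_space_coin)
  show ?thesis
    by unfold_locales
       (simp_all add: space_coin bij_add_one sets_coin prob_low_bits low_bits_less low_bits_Suc_mod
         low_bits_add_one del: power_Suc)
qed

text \<open>
  The bijection carries the \<open>\<sigma>\<close>-algebra along with the points, so the system only changes its
  underlying set.
\<close>

lemma odometer_embed:
  assumes "odometer M T d" and f: "bij f"
  shows "odometer (embed_measure M f) (f \<circ> T \<circ> inv f) (\<lambda>k. d k \<circ> inv f)"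
proof -
  interpret odometer M T d by fact
  have inj: "inj f" using f by (rule bij_is_inj)
  have image: "f ` A = inv f -` A" for A
    using f by (simp add: bij_vimage_eq_inv_image[OF bij_imp_bij_inv] inv_inv_eq)
  have sets: "sets (embed_measure M f) = {inv f -` A \<inter> UNIV | A. A \<in> sets M}"
    by (simp add: sets_embed_measure[OF inj] image)
  interpret E: prob_space "embed_measure M f"
    by (subst embed_measure_eq_distr[OF inj], rule prob_space_distr, rule measurable_embed_measure2[OF inj])
  show ?thesis
  proof unfold_locales
    show "space (embed_measure M f) = UNIV"
      using f by (simp add: space_embed_measure bij_is_surj)
    show "bij (f \<circ> T \<circ> inv f)"
      using f bij by (intro bij_comp bij_imp_bij_inv)
    show "sets (embed_measure M f) = sigma_sets UNIV {(d k \<circ> inv f) -` {i} | k i. True}"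
    proof -
      have "sets (embed_measure M f) = sigma_sets UNIV {inv f -` A \<inter> UNIV | A. A \<in> {d k -` {i} | k i. True}}"
        unfolding sets sets_eq by (rule sigma_sets_vimage_commute) simp
      also have "{inv f -` A \<inter> UNIV | A. A \<in> {d k -` {i} | k i. True}} = {(d k \<circ> inv f) -` {i} | k i. True}"
        unfolding vimage_comp[symmetric] by blast
      finally show ?thesis .
    qed
    show "E.prob ((d k \<circ> inv f) -` {i}) = 1 / 2 ^ k" if "i < 2 ^ k" for k i
    proof -
      have "(d k \<circ> inv f) -` {i} \<in> sets (embed_measure M f)"
        unfolding sets using cell_event[of k "{i}"] 
        by (intro CollectI exI[of _ "d k -` {i}"]) (auto simp: vimage_comp)
      moreover have "f -` (d k \<circ> inv f) -` {i} = d k -` {i}"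
        using inj by auto
      ultimately show ?thesis
        using prob_cell[OF that] by (simp add: measure_def emeasure_embed_measure[OF inj])
    qed
  qed (use inj in \<open>simp_all add: d_Suc_mod d_T del: power_Suc\<close>)
qed

text \<open>
  The Polish topology is the product topology of the Cantor space, transported along \<open>f\<close>; the sets
  of sequences with given first digits form a countable base and generate the \<open>\<sigma>\<close>-algebra.
\<close>

lemma standard_prob_space_embed_coin:
  fixes f :: "(nat \<Rightarrow> bool) \<Rightarrow> 'b"
  assumes f: "bij f"
  shows "standard_prob_space (embed_measure coin f)"
proof -
  define Y where "Y = product_topology (\<lambda>_ :: nat. discrete_topology (UNIV :: bool set)) UNIV"
  define X where "X = pullback_topology UNIV (inv f) Y"
  have inj: "inj f" using f by (rule bij_is_inj)
  have image: "f ` A = inv f -` A" for A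
    using f by (simp add: bij_vimage_eq_inv_image[OF bij_imp_bij_inv] inv_inv_eq)
  have topY: "topspace Y = UNIV" by (simp add: Y_def)
  have topX: "topspace X = UNIV" by (simp add: X_def topspace_pullback_topology topY)
  have openX: "openin X U \<longleftrightarrow> (\<exists>V. openin Y V \<and> U = inv f -` V)" for U
    by (simp add: X_def openin_pullback_topology)
  have cell_open: "openin Y (low_bits k -` {i})" for k i
    unfolding Y_def openin_product_topology_alt
  proof
    fix x assume x: "x \<in> low_bits k -` {i}"
    define U where "U j = (if j < k then {x j} else UNIV)" for j
    have "finite {j \<in> UNIV. U j \<noteq> topspace (discrete_topology UNIV)}"
      by (rule finite_subset[of _ "{..<k}"]) (auto simp: U_def)
    moreover have "Pi\<^sub>E UNIV U \<subseteq> low_bits k -` {i}"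
      using x by (auto simp: U_def PiE_def Pi_def low_bits_eq_iff split: if_splits)
    moreover have "x \<in> Pi\<^sub>E UNIV U" by (auto simp: U_def)
    ultimately show "\<exists>U. finite {j \<in> UNIV. U j \<noteq> topspace (discrete_topology UNIV)} \<and>
        (\<forall>j\<in>UNIV. openin (discrete_topology UNIV) (U j)) \<and> x \<in> Pi\<^sub>E UNIV U \<and> Pi\<^sub>E UNIV U \<subseteq> low_bits k -` {i}"
      by (intro exI[of _ U]) auto
  qed
  have cell_nbhd: "\<exists>k. low_bits k -` {low_bits k x} \<subseteq> U" if U: "openin Y U" "x \<in> U" for U x
  proof -
    have "\<forall>x\<in>U. \<exists>V. finite {j. V j \<noteq> UNIV} \<and> x \<in> Pi\<^sub>E UNIV V \<and> Pi\<^sub>E UNIV V \<subseteq> U"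
      using U(1) unfolding Y_def openin_product_topology_alt by simp
    then obtain V where V: "finite {j. V j \<noteq> UNIV}" "x \<in> Pi\<^sub>E UNIV V" "Pi\<^sub>E UNIV V \<subseteq> U"
      using U(2) by blast
    obtain k where "{j. V j \<noteq> UNIV} \<subseteq> {..<k}"
      using finite_nat_bounded[OF V(1)] by blast
    then have k: "j < k" if "V j \<noteq> UNIV" for j using that by blast
    have "low_bits k -` {low_bits k x} \<subseteq> Pi\<^sub>E UNIV V"
    proof
      fix y assume "y \<in> low_bits k -` {low_bits k x}"
      then have "y j = x j" if "j < k" for j using that by (auto simp: low_bits_eq_iff)
      then have "y j \<in> V j" for j
        using k[of j] V(2) by (cases "V j = UNIV") auto
      then show "y \<in> Pi\<^sub>E UNIV V" by auto
    qed
    then show ?thesis using V(3) by blast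
  qed
  have cell_sub: "\<exists>k i. x \<in> low_bits k -` {i} \<and> low_bits k -` {i} \<subseteq> U" if "openin Y U" "x \<in> U" for U x
    using cell_nbhd[OF that] by blast
  have countable_cells: "countable {low_bits k -` {i} | k i. True}"
  proof -
    have "{low_bits k -` {i} | k i. True} = (\<lambda>(k, i). low_bits k -` {i}) ` UNIV" by auto
    then show ?thesis by simp
  qed
  have sets_Y: "sets coin = sigma_sets UNIV {U. openin Y U}"
    unfolding sets_coin
  proof (rule sigma_sets_eqI)
    show "A \<in> sigma_sets UNIV {U. openin Y U}" if "A \<in> {low_bits k -` {i} | k i. True}" for A
      using that cell_open by (auto intro: sigma_sets.Basic)
    fix U assume U: "U \<in> {U. openin Y U}"
    have "U = \<Union> {A \<in> {low_bits k -` {i} | k i. True}. A \<subseteq> U}"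
      using cell_sub U by auto blast
    also have "\<dots> \<in> sigma_sets UNIV {low_bits k -` {i} | k i. True}"
    proof (rule sigma_algebra.countable_Union[OF sigma_algebra_sigma_sets])
      show "countable {A \<in> {low_bits k -` {i} | k i. True}. A \<subseteq> U}"
        by (rule countable_subset[OF _ countable_cells]) blast
    qed (auto intro: sigma_sets.Basic)
    finally show "U \<in> sigma_sets UNIV {low_bits k -` {i} | k i. True}" .
  qed
  have "completely_metrizable_space Y"
    unfolding Y_def completely_metrizable_space_product_topology
    by (intro disjI2 conjI ballI) (simp_all add: completely_metrizable_space_discrete_topology)
  moreover have "X homeomorphic_space Y"
    unfolding homeomorphic_space_def homeomorphic_maps_def
  proof (intro exI conjI ballI)
    show "continuous_map X Y (inv f)"
      unfolding X_def using continuous_map_pullback[of Y Y id UNIV "inv f"] by simp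
    show "continuous_map Y X f"
      unfolding X_def using inj by (intro continuous_map_pullback') (simp_all add: comp_def)
  qed (use inj f in \<open>simp_all add: bij_is_surj surj_f_inv_f\<close>)
  ultimately have "completely_metrizable_space X"
    using homeomorphic_completely_metrizable_space by blast
  moreover have "second_countable X"
    unfolding second_countable_def
  proof (intro exI[of _ "(\<lambda>A. inv f -` A) ` {low_bits k -` {i} | k i. True}"] conjI ballI allI impI)
    show "countable ((\<lambda>A. inv f -` A) ` {low_bits k -` {i} | k i. True})"
      using countable_cells by (rule countable_image)
    show "openin X V" if "V \<in> (\<lambda>A. inv f -` A) ` {low_bits k -` {i} | k i. True}" for V
      using that cell_open by (auto simp: openX)
    fix U x assume "openin X U \<and> x \<in> U"
    then obtain V where V: "openin Y V" "U = inv f -` V" "inv f x \<in> V"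
      by (auto simp: openX)
    obtain k i where "inv f x \<in> low_bits k -` {i}" "low_bits k -` {i} \<subseteq> V"
      using cell_sub[OF V(1,3)] by blast
    then have "x \<in> inv f -` (low_bits k -` {i})" "inv f -` (low_bits k -` {i}) \<subseteq> U"
      using V(2) by (simp_all add: vimage_mono)
    then show "\<exists>W\<in>(\<lambda>A. inv f -` A) ` {low_bits k -` {i} | k i. True}. x \<in> W \<and> W \<subseteq> U"
      by (intro bexI[of _ "inv f -` (low_bits k -` {i})"] conjI imageI) (assumption | blast)+
  qed
  moreover have "sets (embed_measure coin f) = sigma_sets UNIV {U. openin X U}"
  proof -
    have "sets (embed_measure coin f) = {inv f -` A \<inter> UNIV | A. A \<in> sigma_sets UNIV {U. openin Y U}}"
      by (simp add: sets_embed_measure[OF inj] image sets_Y)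
    also have "\<dots> = sigma_sets UNIV {inv f -` A \<inter> UNIV | A. A \<in> {U. openin Y U}}"
      by (rule sigma_sets_vimage_commute) auto
    also have "{inv f -` A \<inter> UNIV | A. A \<in> {U. openin Y U}} = {U. openin X U}"
      by (auto simp: openX)
    finally show ?thesis .
  qed
  moreover have "prob_space (embed_measure coin f)"
    using odometer_embed[OF odometer_coin f] by (simp add: odometer_def)
  moreover have "space (embed_measure coin f) = UNIV"
    using f by (simp add: space_embed_measure space_coin bij_is_surj)
  ultimately show ?thesis
    unfolding standard_prob_space_def using topX by auto
qed

lemma bij_binary_sequences_real: "\<exists>f :: (nat \<Rightarrow> bool) \<Rightarrow> real. bij f"
proof -
  obtain g :: "nat set \<Rightarrow> real" where g: "bij g"
    using nat_sets_eqpoll_reals by (auto simp: eqpoll_def)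
  have "bij (Collect :: (nat \<Rightarrow> bool) \<Rightarrow> nat set)"
    by (rule o_bij[of "\<lambda>A x. x \<in> A"]) (auto simp: fun_eq_iff)
  then have "bij (g \<circ> Collect)" using g by (rule bij_comp)
  then show ?thesis by blast
qed

theorem theorem3p1:
  shows "\<exists>(M :: real measure) (T :: real \<Rightarrow> real) (\<alpha> :: real set set) (P :: nat \<Rightarrow> real set set).
    standard_prob_space M \<and> mp_automorphism M T \<and> ergodic M T \<and>
    finite_partition M \<alpha> \<and> generating M T \<alpha> \<and>
    (\<forall>n\<ge>1. finite_partition M (P n)) \<and>
    (\<forall>n\<ge>1. refines_mod_null M (P (Suc n)) (P n)) \<and>
    full_mod_null M (sigma_sets (space M) (\<Union>n\<in>{1..}. P n)) \<and>
    f_functional M T \<alpha> = ks_entropy M T \<and>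
    ks_entropy M T \<noteq>
      liminf (\<lambda>n. ereal (cond_partition_entropy M (P n) (translate M T (- 1) (P n)))) \<and>
    liminf (\<lambda>n. ereal (cond_partition_entropy M (P n) (translate M T (- 1) (P n)))) =
      liminf (\<lambda>n. ereal (F_functional M T (P n)))"
proof -
  obtain f :: "(nat \<Rightarrow> bool) \<Rightarrow> real" where f: "bij f"
    using bij_binary_sequences_real by blast
  define M where "M = embed_measure coin f"
  define T where "T = f \<circ> add_one \<circ> inv f"
  interpret odometer M T "\<lambda>k. low_bits k \<circ> inv f"
    unfolding M_def T_def using odometer_coin f by (rule odometer_embed)
  define \<alpha> where "\<alpha> = label_partition M toeplitz"
  define P where "P n = label_partition M (staggered n)" for n
  have f_eq: "f_functional M T \<alpha> = 0"
    unfolding \<alpha>_def using simple_function_toeplitz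
    by (intro f_functional_eq_0 word_entropy_rate_0)
  have ks_eq: "ks_entropy M T = 0"
    by (intro ks_entropy_eq_0 word_entropy_rate_0)
  have cond_eq: "cond_partition_entropy M (P n) (translate M T (- 1) (P n)) = F_functional M T (P n)" for n
    unfolding P_def by (intro cond_partition_entropy_label simple_function_staggered)
  have "(\<lambda>n. ereal (F_functional M T (P n))) \<longlonglongrightarrow> ereal (ln 2 / 2)"
    by (rule tendsto_eventually, rule eventually_sequentiallyI[of 1])
       (simp add: P_def F_functional_staggered)
  then have liminf_eq: "liminf (\<lambda>n. ereal (F_functional M T (P n))) = ereal (ln 2 / 2)"
    by (intro lim_imp_Liminf) auto
  show ?thesis
  proof (intro exI[of _ M] exI[of _ T] exI[of _ \<alpha>] exI[of _ P] conjI allI impI)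
    show "standard_prob_space M"
      unfolding M_def using f by (rule standard_prob_space_embed_coin)
    show "mp_automorphism M T" by (rule automorphism)
    show "ergodic M T" by (rule ergodic_odometer)
    show "finite_partition M \<alpha>"
      unfolding \<alpha>_def using simple_function_toeplitz by (rule finite_partition_label)
    show "generating M T \<alpha>"
      unfolding \<alpha>_def by (rule generating_toeplitz)
    show "finite_partition M (P n)" for n
      unfolding P_def using simple_function_staggered by (rule finite_partition_label)
    show "refines_mod_null M (P (Suc n)) (P n)" if "1 \<le> n" for n
      unfolding P_def using that by (rule staggered_refines)
    show "full_mod_null M (sigma_sets (space M) (\<Union>n\<in>{1..}. P n))"
      unfolding P_def by (rule staggered_generate)
    show "f_functional M T \<alpha> = ks_entropy M T"
      by (simp add: f_eq ks_eq)
    show "ks_entropy M T \<noteq>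
        liminf (\<lambda>n. ereal (cond_partition_entropy M (P n) (translate M T (- 1) (P n))))"
      by (simp add: ks_eq cond_eq liminf_eq zero_ereal_def)
    show "liminf (\<lambda>n. ereal (cond_partition_entropy M (P n) (translate M T (- 1) (P n)))) =
        liminf (\<lambda>n. ereal (F_functional M T (P n)))"
      by (simp only: cond_eq)
  qed
qed

end
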